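(* Let $k$ be a field, $X$ a well-ordered set and $\Omega=\bigcup_{m\ge 1}\Omega_m$ a well-ordered set of operators. Then $Lie(\Omega;X)$ is a free Lie $\Omega$-algebra on the set $X$, and the set $NLSW(\Omega;X)$ of all non-associative Lyndon-Shirshov $\Omega$-words is a linear basis of $Lie(\Omega;X)$.
   Context: **Words.** $k$ is a field, $X$ a set, $\Omega=\bigcup_{m\ge1}\Omega_m$ where $\Omega_m$ is a set of $m$-ary operator symbols; $X$ and $\Omega$ carry well orders. For a set $Y$: $S(Y)$ is the set of nonempty associative words on $Y$, $Y^*=S(Y)\cup\{1\}$ ($1$ the empty word), $Y^{**}$ the set of non-associative (fully bracketed) words on $Y$, and $\Omega(Y)=\bigcup_m\{\omega(y_1,\dots,y_m): y_i\in Y,\ \omega\in\Omega_m\}$ (formal expressions). Put $\langle\Omega;X\rangle_0=S(X)$, $\langle\Omega;X\rangle_n=S(X\cup\Omega(\langle\Omega;X\rangle_{n-1}))$, $\langle\Omega;X\rangle=\bigcup_n\langle\Omega;X\rangle_n$ (associative $\Omega$-words). **Order.** Elements of $X\cup\Omega(\langle\Omega;X\rangle)$ are called prime; each $u\in\langle\Omega;X\rangle$ is uniquely $u=u_1\cdots u_n$ with $u_i$ prime, and $bre(u)=n$; $deg(u)$ is the total number of occurrences of elements of $X$ and $\Omega$ in $u$. Put $wt(u)=(deg(u),bre(u),u_1,\dots,u_n)$. The order $>_{Dl}$ on $\langle\Omega;X\rangle$: $u>_{Dl}v$ iff $wt(u)>wt(v)$ lexicographically, where primes are compared first by degree; primes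 of degree $1$ are elements of $X$, compared by the order of $X$; primes $\omega(a_1,\dots,a_t)$, $\theta(b_1,\dots,b_l)$ of equal degree are compared by comparing $(\omega,a_1,\dots,a_t)$ and $(\theta,b_1,\dots,b_l)$ lexicographically (operators by the order of $\Omega$, arguments recursively by $>_{Dl}$). Let $\succ$ be the restriction of $>_{Dl}$ to prime elements. **Lyndon-Shirshov words.** For an ordered set $Z$, the lex order on $Z^*$: $1>_{lex}u$ for every nonempty $u$, and $zu'>_{lex}z'v'$ ($z,z'\in Z$) iff $z>z'$, or $z=z'$ and $u'>_{lex}v'$. $ALSW(Z)$ is the set of nonempty words $w$ with $uv>_{lex}vu$ for every factorization $w=uv$ with $u,v\ne1$. $NLSW(Z)$ is the set of non-associative words $(u)$ such that: the underlying associative word $u$ is in $ALSW(Z)$; if $(u)=((v)(w))$ then $(v),(w)\in NLSW(Z)$; and if moreover $(v)=((v_1)(v_2))$ then $v_2\le_{lex}w$. Each $u\in ALSW(Z)$ has exactly one bracketing $[u]\in NLSW(Z)$ (the Shirshov standard bracketing). **Lyndon-Shirshov $\Omega$-words.** $ALSW(\Omega;X)_0=ALSW(X)$, $ALSW(\Omega;X)_n=ALSW(X\cup\Omega(ALSW(\Omega;X)_{n-1}))$ with respect to $\succ_{lex}$, and $ALSW(\Omega;X)=\bigcup_nALSW(\Omega;X)_n$. The bracketing $[u]$ of $u\in ALSW(\Omega;X)$: $[x]=x$ for $x\in X$; $[\omega(u_1,\dots,u_m)]=\omega([u_1],\dots,[u_m])$; for $u=u_1\cdots u_m$ with $u_i$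 prime, $[u]$ is the Shirshov standard bracketing of the word $[u_1][u_2]\cdots[u_m]$ in the letters $[u_1],\dots,[u_m]$, ordered by $[p]\succ[q]$ iff $p\succ q$. $NLSW(\Omega;X)=\{[u]:u\in ALSW(\Omega;X)\}$. **Algebras.** An associative (resp. Lie) $\Omega$-algebra over $k$ is an associative (resp. Lie) $k$-algebra together with, for each $\omega\in\Omega_m$, an $m$-ary multilinear operation. Homomorphisms are algebra homomorphisms commuting with all operators. A Lie $\Omega$-algebra $F$ with an injective map $i:X\to F$ is free on $X$ if every map $\sigma$ from $X$ to a Lie $\Omega$-algebra $A$ has a unique Lie $\Omega$-algebra homomorphism $\tilde\sigma:F\to A$ with $\tilde\sigma i=\sigma$. $k\langle\Omega;X\rangle$ is the $k$-space with basis $\langle\Omega;X\rangle$, with concatenation as product and operators extended multilinearly (the free associative $\Omega$-algebra on $X$). $Lie(\Omega;X)$ is the Lie $\Omega$-subalgebra of $k\langle\Omega;X\rangle$ generated by $X$ under the bracket $(uv)=uv-vu$ (and all operators); elements of $NLSW(\Omega;X)$ are regarded as elements of $Lie(\Omega;X)$ by reading brackets as commutators. *)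

theory Defs
  imports HOL.Vector_Spaces "HOL-Library.Poly_Mapping" "HOL-Library.FuncSet"
begin

section \<open>Words\<close>

text \<open>
  An associative \<open>\<Omega>\<close>-word is a nonempty list of prime words. The datatype does not enforce
  nonemptiness, arities or membership of the symbols in \<open>X\<close> and \<open>\<Omega>\<close>; the set \<open>owords\<close> below does.
  \<open>X\<close> and \<open>\<Omega>\<close> are arbitrary subsets (possibly empty) of well-ordered types, and
  \<open>\<Omega>\<^sub>m = {\<omega> \<in> \<Omega>. ar \<omega> = m}\<close>.
\<close>

datatype ('x, 'o) prime_word = Var 'x | Op 'o "('x, 'o) prime_word list list"

type_synonym ('x, 'o) oword = "('x, 'o) prime_word list"

definition words_on :: "'z set \<Rightarrow> 'z list set" where
  "words_on Y = {w. w \<noteq> [] \<and> set w \<subseteq> Y}"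

definition op_words :: "'o set \<Rightarrow> ('o \<Rightarrow> nat) \<Rightarrow> ('x, 'o) oword set \<Rightarrow> ('x, 'o) prime_word set" where
  "op_words \<Omega> ar Y = {Op \<omega> us | \<omega> us. \<omega> \<in> \<Omega> \<and> length us = ar \<omega> \<and> set us \<subseteq> Y}"

fun owords_level :: "'x set \<Rightarrow> 'o set \<Rightarrow> ('o \<Rightarrow> nat) \<Rightarrow> nat \<Rightarrow> ('x, 'o) oword set" where
  "owords_level X \<Omega> ar 0 = words_on (Var ` X)"
| "owords_level X \<Omega> ar (Suc n) = words_on (Var ` X \<union> op_words \<Omega> ar (owords_level X \<Omega> ar n))"

definition owords :: "'x set \<Rightarrow> 'o set \<Rightarrow> ('o \<Rightarrow> nat) \<Rightarrow> ('x, 'o) oword set" where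
  "owords X \<Omega> ar = (\<Union>n. owords_level X \<Omega> ar n)"


section \<open>The order on associative \<open>\<Omega>\<close>-words\<close>

fun prime_deg :: "('x, 'o) prime_word \<Rightarrow> nat" where
  "prime_deg (Var x) = 1"
| "prime_deg (Op \<omega> us) = 1 + (\<Sum>u\<leftarrow>us. \<Sum>p\<leftarrow>u. prime_deg p)"

definition deg :: "('x, 'o) oword \<Rightarrow> nat" where
  "deg u = (\<Sum>p\<leftarrow>u. prime_deg p)"

text \<open>
  A lexicographic comparison of tuples of the same length is written out as the comparison
  at the first position where the tuples differ; \<open>cs\<close> is the common initial part.
\<close>

inductive prime_gt :: "('x::wellorder, 'o::wellorder) prime_word \<Rightarrow> ('x, 'o) prime_word \<Rightarrow> bool"
  and Dl_gt :: "('x::wellorder, 'o::wellorder) oword \<Rightarrow> ('x, 'o) oword \<Rightarrow> bool"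
where
  prime_deg: "prime_deg p > prime_deg q \<Longrightarrow> prime_gt p q"
| prime_var: "x > y \<Longrightarrow> prime_gt (Var x) (Var y)"
| prime_op: "prime_deg (Op \<omega> as) = prime_deg (Op \<theta> bs) \<Longrightarrow> \<omega> > \<theta> \<Longrightarrow>
    prime_gt (Op \<omega> as) (Op \<theta> bs)"
| prime_args: "prime_deg (Op \<omega> (cs @ a # as)) = prime_deg (Op \<omega> (cs @ b # bs)) \<Longrightarrow> Dl_gt a b \<Longrightarrow>
    prime_gt (Op \<omega> (cs @ a # as)) (Op \<omega> (cs @ b # bs))"
| Dl_deg: "deg u > deg v \<Longrightarrow> Dl_gt u v"
| Dl_bre: "deg u = deg v \<Longrightarrow> length u > length v \<Longrightarrow> Dl_gt u v"
| Dl_lex: "deg (cs @ p # u) = deg (cs @ q # v) \<Longrightarrow> length u = length v \<Longrightarrow> prime_gt p q \<Longrightarrow>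
    Dl_gt (cs @ p # u) (cs @ q # v)"

definition succ_gt :: "('x::wellorder, 'o::wellorder) prime_word \<Rightarrow> ('x, 'o) prime_word \<Rightarrow> bool" where
  "succ_gt p q \<longleftrightarrow> Dl_gt [p] [q]"


section \<open>Lyndon-Shirshov words\<close>

text \<open>
  The order on the alphabet is given by its strict \<open>greater than\<close> relation \<open>gt\<close>.
  A proper prefix of a word is greater than the word.
\<close>

fun lex_gt :: "('z \<Rightarrow> 'z \<Rightarrow> bool) \<Rightarrow> 'z list \<Rightarrow> 'z list \<Rightarrow> bool" where
  "lex_gt gt u [] \<longleftrightarrow> False"
| "lex_gt gt [] (z # v) \<longleftrightarrow> True"
| "lex_gt gt (y # u) (z # v) \<longleftrightarrow> gt y z \<or> y = z \<and> lex_gt gt u v"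

definition ALSW :: "('z \<Rightarrow> 'z \<Rightarrow> bool) \<Rightarrow> 'z set \<Rightarrow> 'z list set" where
  "ALSW gt Z = {w \<in> words_on Z.
     \<forall>u v. w = u @ v \<and> u \<noteq> [] \<and> v \<noteq> [] \<longrightarrow> lex_gt gt (u @ v) (v @ u)}"

datatype 'z nword = Leaf 'z | Br "'z nword" "'z nword"

fun assoc_word :: "'z nword \<Rightarrow> 'z list" where
  "assoc_word (Leaf z) = [z]"
| "assoc_word (Br s t) = assoc_word s @ assoc_word t"

fun is_NLSW :: "('z \<Rightarrow> 'z \<Rightarrow> bool) \<Rightarrow> 'z set \<Rightarrow> 'z nword \<Rightarrow> bool" where
  "is_NLSW gt Z (Leaf z) \<longleftrightarrow> [z] \<in> ALSW gt Z"
| "is_NLSW gt Z (Br v w) \<longleftrightarrow>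
     assoc_word (Br v w) \<in> ALSW gt Z \<and> is_NLSW gt Z v \<and> is_NLSW gt Z w \<and>
     (\<forall>v\<^sub>1 v\<^sub>2. v = Br v\<^sub>1 v\<^sub>2 \<longrightarrow>
        assoc_word v\<^sub>2 = assoc_word w \<or> lex_gt gt (assoc_word w) (assoc_word v\<^sub>2))"

definition NLSW :: "('z \<Rightarrow> 'z \<Rightarrow> bool) \<Rightarrow> 'z set \<Rightarrow> 'z nword set" where
  "NLSW gt Z = {t. is_NLSW gt Z t}"

definition shirshov_bracketing :: "('z \<Rightarrow> 'z \<Rightarrow> bool) \<Rightarrow> 'z list \<Rightarrow> 'z nword" where
  "shirshov_bracketing gt u = (THE t. t \<in> NLSW gt (set u) \<and> assoc_word t = u)"


section \<open>Lyndon-Shirshov \<open>\<Omega>\<close>-words\<close>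

fun ALSW_level ::
  "'x::wellorder set \<Rightarrow> 'o::wellorder set \<Rightarrow> ('o \<Rightarrow> nat) \<Rightarrow> nat \<Rightarrow> ('x, 'o) oword set" where
  "ALSW_level X \<Omega> ar 0 = ALSW succ_gt (Var ` X)"
| "ALSW_level X \<Omega> ar (Suc n) = ALSW succ_gt (Var ` X \<union> op_words \<Omega> ar (ALSW_level X \<Omega> ar n))"

definition ALSW_op ::
  "'x::wellorder set \<Rightarrow> 'o::wellorder set \<Rightarrow> ('o \<Rightarrow> nat) \<Rightarrow> ('x, 'o) oword set" where
  "ALSW_op X \<Omega> ar = (\<Union>n. ALSW_level X \<Omega> ar n)"

text \<open>
  A non-associative \<open>\<Omega>\<close>-word is a bracketed word in letters of type \<open>nprime\<close>.
\<close>

datatype ('x, 'o) nprime = NVar 'x | NOp 'o "('x, 'o) nprime nword list"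

text \<open>
  The letters \<open>[p]\<close> of the word \<open>[u\<^sub>1]\<cdots>[u\<^sub>m]\<close> are ordered by \<open>[p] \<succ> [q] \<longleftrightarrow> p \<succ> q\<close>. To express this,
  each letter \<open>[p]\<close> is carried along as the pair \<open>(p, [p])\<close>; the first components are
  dropped once the word is bracketed.
\<close>

definition bracket_letters ::
  "(('x::wellorder, 'o::wellorder) prime_word \<times> 'n) list \<Rightarrow> 'n nword" where
  "bracket_letters l = map_nword snd (shirshov_bracketing (\<lambda>a b. succ_gt (fst a) (fst b)) l)"

fun bracket_prime :: "('x::wellorder, 'o::wellorder) prime_word \<Rightarrow> ('x, 'o) nprime" where
  "bracket_prime (Var x) = NVar x"
| "bracket_prime (Op \<omega> us) =
     NOp \<omega> (map (\<lambda>u. bracket_letters (map (\<lambda>p. (p, bracket_prime p)) u)) us)"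

definition bracketing :: "('x::wellorder, 'o::wellorder) oword \<Rightarrow> ('x, 'o) nprime nword" where
  "bracketing u = bracket_letters (map (\<lambda>p. (p, bracket_prime p)) u)"

definition NLSW_op ::
  "'x::wellorder set \<Rightarrow> 'o::wellorder set \<Rightarrow> ('o \<Rightarrow> nat) \<Rightarrow> ('x, 'o) nprime nword set" where
  "NLSW_op X \<Omega> ar = bracketing ` ALSW_op X \<Omega> ar"


section \<open>Lie \<open>\<Omega>\<close>-algebras\<close>

text \<open>
  The underlying space is a subspace \<open>L\<close> of a vector space on the type \<open>'v\<close>. The Lie bracket
  and the operators are only specified on \<open>L\<close>; an operator takes the list of its arguments.
\<close>

locale lie_omega_algebra = vector_space scale
  for scale :: "'k::field \<Rightarrow> 'v::ab_group_add \<Rightarrow> 'v" +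
  fixes \<Omega> :: "'o set" and ar :: "'o \<Rightarrow> nat"
    and L :: "'v set" and br :: "'v \<Rightarrow> 'v \<Rightarrow> 'v" and opr :: "'o \<Rightarrow> 'v list \<Rightarrow> 'v"
  assumes subspace_L: "subspace L"
    and br_closed: "\<lbrakk>x \<in> L; y \<in> L\<rbrakk> \<Longrightarrow> br x y \<in> L"
    and br_add_left: "\<lbrakk>x \<in> L; y \<in> L; z \<in> L\<rbrakk> \<Longrightarrow> br (x + y) z = br x z + br y z"
    and br_add_right: "\<lbrakk>x \<in> L; y \<in> L; z \<in> L\<rbrakk> \<Longrightarrow> br x (y + z) = br x y + br x z"
    and br_scale_left: "\<lbrakk>x \<in> L; y \<in> L\<rbrakk> \<Longrightarrow> br (scale c x) y = scale c (br x y)"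
    and br_scale_right: "\<lbrakk>x \<in> L; y \<in> L\<rbrakk> \<Longrightarrow> br x (scale c y) = scale c (br x y)"
    and br_self: "x \<in> L \<Longrightarrow> br x x = 0"
    and jacobi: "\<lbrakk>x \<in> L; y \<in> L; z \<in> L\<rbrakk> \<Longrightarrow> br x (br y z) + br y (br z x) + br z (br x y) = 0"
    and opr_closed: "\<lbrakk>\<omega> \<in> \<Omega>; length xs = ar \<omega>; set xs \<subseteq> L\<rbrakk> \<Longrightarrow> opr \<omega> xs \<in> L"
    and opr_add: "\<lbrakk>\<omega> \<in> \<Omega>; length xs = ar \<omega>; set xs \<subseteq> L; i < ar \<omega>; x \<in> L; y \<in> L\<rbrakk> \<Longrightarrow>
      opr \<omega> (xs[i := x + y]) = opr \<omega> (xs[i := x]) + opr \<omega> (xs[i := y])"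
    and opr_scale: "\<lbrakk>\<omega> \<in> \<Omega>; length xs = ar \<omega>; set xs \<subseteq> L; i < ar \<omega>; x \<in> L\<rbrakk> \<Longrightarrow>
      opr \<omega> (xs[i := scale c x]) = scale c (opr \<omega> (xs[i := x]))"

definition lie_omega_subalgebra ::
  "('k::field \<Rightarrow> 'v::ab_group_add \<Rightarrow> 'v) \<Rightarrow> 'o set \<Rightarrow> ('o \<Rightarrow> nat) \<Rightarrow> 'v set \<Rightarrow>
   ('v \<Rightarrow> 'v \<Rightarrow> 'v) \<Rightarrow> ('o \<Rightarrow> 'v list \<Rightarrow> 'v) \<Rightarrow> 'v set \<Rightarrow> bool" where
  "lie_omega_subalgebra scale \<Omega> ar L br opr M \<longleftrightarrow>
     M \<subseteq> L \<and> module.subspace scale M \<and> (\<forall>x\<in>M. \<forall>y\<in>M. br x y \<in> M) \<and>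
     (\<forall>\<omega>\<in>\<Omega>. \<forall>xs. length xs = ar \<omega> \<and> set xs \<subseteq> M \<longrightarrow> opr \<omega> xs \<in> M)"

definition lie_omega_hom ::
  "'o set \<Rightarrow> ('o \<Rightarrow> nat) \<Rightarrow>
   ('k::field \<Rightarrow> 'v::ab_group_add \<Rightarrow> 'v) \<Rightarrow> 'v set \<Rightarrow> ('v \<Rightarrow> 'v \<Rightarrow> 'v) \<Rightarrow> ('o \<Rightarrow> 'v list \<Rightarrow> 'v) \<Rightarrow>
   ('k \<Rightarrow> 'a::ab_group_add \<Rightarrow> 'a) \<Rightarrow> 'a set \<Rightarrow> ('a \<Rightarrow> 'a \<Rightarrow> 'a) \<Rightarrow> ('o \<Rightarrow> 'a list \<Rightarrow> 'a) \<Rightarrow>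
   ('v \<Rightarrow> 'a) \<Rightarrow> bool" where
  "lie_omega_hom \<Omega> ar scale L br opr scale' L' br' opr' f \<longleftrightarrow>
     f \<in> L \<rightarrow> L' \<and>
     (\<forall>x\<in>L. \<forall>y\<in>L. f (x + y) = f x + f y) \<and>
     (\<forall>c. \<forall>x\<in>L. f (scale c x) = scale' c (f x)) \<and>
     (\<forall>x\<in>L. \<forall>y\<in>L. f (br x y) = br' (f x) (f y)) \<and>
     (\<forall>\<omega>\<in>\<Omega>. \<forall>xs. length xs = ar \<omega> \<and> set xs \<subseteq> L \<longrightarrow> f (opr \<omega> xs) = opr' \<omega> (map f xs))"

text \<open>
  The universal property is stated for all Lie \<open>\<Omega>\<close>-algebras on subspaces of the type \<open>'a\<close>.
  A theorem in which \<open>'a\<close> is a type variable thus asserts it for all Lie \<open>\<Omega>\<close>-algebras.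
  Homomorphisms only matter on \<open>F\<close>, so uniqueness is among functions that are undefined off \<open>F\<close>.
\<close>

definition free_lie_omega_algebra ::
  "'a::ab_group_add itself \<Rightarrow> 'o set \<Rightarrow> ('o \<Rightarrow> nat) \<Rightarrow> 'x set \<Rightarrow>
   ('k::field \<Rightarrow> 'v::ab_group_add \<Rightarrow> 'v) \<Rightarrow> 'v set \<Rightarrow> ('v \<Rightarrow> 'v \<Rightarrow> 'v) \<Rightarrow> ('o \<Rightarrow> 'v list \<Rightarrow> 'v) \<Rightarrow>
   ('x \<Rightarrow> 'v) \<Rightarrow> bool" where
  "free_lie_omega_algebra _ \<Omega> ar X scale F br opr i \<longleftrightarrow>
     lie_omega_algebra scale \<Omega> ar F br opr \<and> i \<in> X \<rightarrow> F \<and> inj_on i X \<and>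
     (\<forall>(scale' :: 'k \<Rightarrow> 'a \<Rightarrow> 'a) A br' opr' \<sigma>.
        lie_omega_algebra scale' \<Omega> ar A br' opr' \<and> \<sigma> \<in> X \<rightarrow> A \<longrightarrow>
        (\<exists>!\<tau>. \<tau> \<in> extensional F \<and> lie_omega_hom \<Omega> ar scale F br opr scale' A br' opr' \<tau> \<and>
               (\<forall>x\<in>X. \<tau> (i x) = \<sigma> x)))"


section \<open>The free associative \<open>\<Omega>\<close>-algebra and \<open>Lie(\<Omega>;X)\<close>\<close>

type_synonym ('x, 'o, 'k) opoly = "('x, 'o) oword \<Rightarrow>\<^sub>0 'k"

definition opolys :: "'x set \<Rightarrow> 'o set \<Rightarrow> ('o \<Rightarrow> nat) \<Rightarrow> ('x, 'o, 'k::field) opoly set" where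
  "opolys X \<Omega> ar = {f. Poly_Mapping.keys f \<subseteq> owords X \<Omega> ar}"

definition opoly_scale :: "'k \<Rightarrow> ('x, 'o, 'k::field) opoly \<Rightarrow> ('x, 'o, 'k) opoly" where
  "opoly_scale c f = Poly_Mapping.map ((*) c) f"

definition opoly_mult ::
  "('x, 'o, 'k::field) opoly \<Rightarrow> ('x, 'o, 'k) opoly \<Rightarrow> ('x, 'o, 'k) opoly" where
  "opoly_mult f g = (\<Sum>u\<in>Poly_Mapping.keys f. \<Sum>v\<in>Poly_Mapping.keys g.
     Poly_Mapping.single (u @ v) (Poly_Mapping.lookup f u * Poly_Mapping.lookup g v))"

definition opoly_op :: "'o \<Rightarrow> ('x, 'o, 'k::field) opoly list \<Rightarrow> ('x, 'o, 'k) opoly" where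
  "opoly_op \<omega> fs = (\<Sum>us\<in>listset (map Poly_Mapping.keys fs).
     Poly_Mapping.single [Op \<omega> us] (prod_list (map2 Poly_Mapping.lookup fs us)))"

definition opoly_commutator ::
  "('x, 'o, 'k::field) opoly \<Rightarrow> ('x, 'o, 'k) opoly \<Rightarrow> ('x, 'o, 'k) opoly" where
  "opoly_commutator f g = opoly_mult f g - opoly_mult g f"

definition opoly_gen :: "'x \<Rightarrow> ('x, 'o, 'k::field) opoly" where
  "opoly_gen x = Poly_Mapping.single [Var x] 1"

definition Lie_op :: "'x set \<Rightarrow> 'o set \<Rightarrow> ('o \<Rightarrow> nat) \<Rightarrow> ('x, 'o, 'k::field) opoly set" where
  "Lie_op X \<Omega> ar =
     lie_omega_subalgebra opoly_scale \<Omega> ar (opolys X \<Omega> ar) opoly_commutator opoly_op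
       hull (opoly_gen ` X)"

text \<open>Non-associative \<open>\<Omega>\<close>-words as elements of the algebra, with brackets read as commutators.\<close>

primrec commutator_value :: "('x, 'o, 'k::field) opoly nword \<Rightarrow> ('x, 'o, 'k) opoly" where
  "commutator_value (Leaf f) = f"
| "commutator_value (Br s t) = opoly_commutator (commutator_value s) (commutator_value t)"

primrec nprime_value :: "('x, 'o) nprime \<Rightarrow> ('x, 'o, 'k::field) opoly" where
  "nprime_value (NVar x) = opoly_gen x"
| "nprime_value (NOp \<omega> ts) = opoly_op \<omega> (map commutator_value (map (map_nword nprime_value) ts))"

definition nword_value :: "('x, 'o) nprime nword \<Rightarrow> ('x, 'o, 'k::field) opoly" where
  "nword_value t = commutator_value (map_nword nprime_value t)"

end

theory Submission
  imports Defs "HOL-Library.Sublist" "HOL-Library.Product_Plus"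
begin

text \<open>
  Two facts about Lyndon-Shirshov words carry the theorem: in every Lie \<open>\<Omega>\<close>-algebra the values of
  the bracketed words \<open>[u]\<close> span the subalgebra generated by the images of \<open>X\<close>, and in
  \<open>k\<langle>\<Omega>;X\<rangle>\<close> these values are linearly independent. Spanning is needed for all Lie
  \<open>\<Omega>\<close>-algebras at once, because freeness is deduced from it.

  \<^bold>\<open>Spanning\<close> (\<open>generated_subalgebra_eq_span\<close>). The span of the values is closed
  under the operators by multilinearity, since \<open>\<omega>([u\<^sub>1],\<dots>,[u\<^sub>m])\<close> is itself the bracketing of a one-letter
  word. That it is closed under the Lie product concerns only an ordered alphabet, here the prime
  Lyndon-Shirshov words, and a Lie algebra: if \<open>l > m\<close> are Lyndon-Shirshov words, then the product of
  \<open>[l]\<close> and \<open>[m]\<close> is a combination of values of words greater than \<open>m\<close> that have length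
  \<open>|l| + |m|\<close> (\<open>br_val_in_span_above\<close>). Either \<open>[l][m]\<close> is already the standard bracketing
  of \<open>lm\<close>, or the Jacobi identity splits \<open>[l]\<close> and produces products in which the smaller factor is
  greater than \<open>m\<close>; only finitely many words of a given length are available, so this ends.

  \<^bold>\<open>Independence\<close> (\<open>leading_word_word_val\<close>, \<open>leading_words_independent\<close>). The greatest word that occurs
  in the value of \<open>[u]\<close> is \<open>u\<close>, with coefficient 1: in a commutator \<open>[v][w] - [w][v]\<close> the first
  product has leading word \<open>vw\<close>, the second \<open>wv\<close>, and \<open>vw > wv\<close> because \<open>vw\<close> is a Lyndon-Shirshov
  word. Elements with distinct leading words are independent.

  \<^bold>\<open>Freeness\<close> (\<open>lift_to_lie_omega_algebra\<close>). Given \<open>\<sigma> : X \<rightarrow> A\<close>, consider the subalgebra \<open>G\<close> of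
  \<open>k\<langle>\<Omega>;X\<rangle> \<times> A\<close> generated by the pairs \<open>(x, \<sigma> x)\<close>. By the spanning result \<open>G\<close> is spanned by the
  values of the \<open>[u]\<close> in the product, and their first components are independent. Hence the
  first projection is injective on \<open>G\<close> and maps it onto \<open>Lie(\<Omega>;X)\<close>, so \<open>G\<close> is the graph of a
  homomorphism \<open>Lie(\<Omega>;X) \<rightarrow> A\<close>.
\<close>

section \<open>Lyndon words over an ordered alphabet\<close>

lemma assoc_word_nonempty: "assoc_word t \<noteq> []"
  by (induction t) auto

text \<open>
  The order is total on \<open>Z\<close> only, because terms of the type of prime words that violate the arities
  or contain empty arguments are not all comparable.
\<close>

locale ordered_alphabet =
  fixes gt :: "'z \<Rightarrow> 'z \<Rightarrow> bool" and Z :: "'z set"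
  assumes irrefl: "\<not> gt a a"
    and trans: "gt a b \<Longrightarrow> gt b c \<Longrightarrow> gt a c"
    and total: "a \<in> Z \<Longrightarrow> b \<in> Z \<Longrightarrow> a = b \<or> gt a b \<or> gt b a"
begin

abbreviation lex_greater (infix \<open>\<succ>\<close> 50) where "u \<succ> v \<equiv> lex_gt gt u v"

lemma lex_gt_iff_lexord: "u \<succ> v \<longleftrightarrow> (u, v) \<in> lexord {(a, b). gt a b}"
  by (induction gt u v rule: lex_gt.induct) auto

lemma lex_gt_irrefl: "\<not> u \<succ> u"
  by (simp add: lex_gt_iff_lexord lexord_irreflexive irrefl)

lemma lex_gt_trans: "u \<succ> v \<Longrightarrow> v \<succ> w \<Longrightarrow> u \<succ> w"
  unfolding lex_gt_iff_lexord by (rule lexord_trans) (auto simp: trans_def intro: trans)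

lemma lex_gt_asym: "u \<succ> v \<Longrightarrow> \<not> v \<succ> u"
  using lex_gt_irrefl lex_gt_trans by blast

lemma lex_gt_total:
  "set u \<subseteq> Z \<Longrightarrow> set v \<subseteq> Z \<Longrightarrow> u = v \<or> u \<succ> v \<or> v \<succ> u"
proof (induction u arbitrary: v)
  case Nil
  then show ?case by (cases v) auto
next
  case (Cons a u)
  then show ?case using total by (cases v) auto
qed

lemma lex_gt_cancel: "p @ u \<succ> p @ v \<longleftrightarrow> u \<succ> v"
  by (simp add: lex_gt_iff_lexord irrefl lexord_same_pref_iff)

lemma prefix_lex_gt: "v \<noteq> [] \<Longrightarrow> u \<succ> u @ v"
  by (cases v) (auto simp: lex_gt_iff_lexord intro!: lexord_append_rightI)

lemma lex_gt_extend: "u \<succ> v \<Longrightarrow> length v \<le> length u \<Longrightarrow> u @ x \<succ> v @ y"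
  by (simp add: lex_gt_iff_lexord lexord_sufI)

text \<open>
  The two ways to be greater behave differently under extension: a difference at some position
  survives whatever is appended, whereas a proper prefix carries no such information.
\<close>

lemma lex_gt_cases:
  assumes "u \<succ> v"
  obtains (prefix) x where "x \<noteq> []" "v = u @ x" | (differ) "\<And>x y. u @ x \<succ> v @ y"
  using assms
proof (induction u arbitrary: v thesis)
  case Nil
  then show ?case by (cases v) auto
next
  case (Cons a u)
  from Cons.prems obtain b v' where v: "v = b # v'" by (cases v) auto
  show ?case
  proof (cases "gt a b")
    case True
    then show ?thesis using Cons.prems v by auto
  next
    case False
    with Cons.prems v have *: "a = b" "u \<succ> v'" by auto
    show ?thesis
      by (rule Cons.IH[OF _ _ *(2)]) (use Cons.prems v * in auto)
  qed
qed

text \<open>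
  With the prefix convention of \<open>lex_gt\<close> (a prefix is greater), Lyndon-Shirshov words are the Lyndon
  words of the reversed order of the alphabet, and the classical characterization by suffixes
  holds. The critical case is that a suffix \<open>v\<close> is also a prefix, \<open>w = uv = vt\<close>: the
  rotations \<open>vu\<close> and \<open>tv\<close> then force \<open>u < t\<close> and \<open>t < u\<close> at equal length.
\<close>

lemma ALSW_iff_greater_than_suffixes:
  "w \<in> ALSW gt Z \<longleftrightarrow>
    w \<in> words_on Z \<and> (\<forall>u v. w = u @ v \<longrightarrow> u \<noteq> [] \<longrightarrow> v \<noteq> [] \<longrightarrow> w \<succ> v)"
proof (intro iffI conjI allI impI)
  assume w: "w \<in> ALSW gt Z"
  then show "w \<in> words_on Z" by (simp add: ALSW_def)
  fix u v assume uv: "w = u @ v" "u \<noteq> []" "v \<noteq> []"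
  have rot: "w \<succ> v' @ u'" if "w = u' @ v'" "u' \<noteq> []" "v' \<noteq> []" for u' v'
    using w that by (auto simp: ALSW_def)
  show "w \<succ> v"
  proof (rule ccontr)
    assume "\<not> w \<succ> v"
    moreover have "w \<noteq> v" using uv by auto
    moreover have "set w \<subseteq> Z" "set v \<subseteq> Z" using w uv by (auto simp: ALSW_def words_on_def)
    ultimately have "v \<succ> w" using lex_gt_total by blast
    then show False
    proof (cases rule: lex_gt_cases)
      case (prefix t)
      then have len: "length t = length u" using uv by (metis add.commute add_right_imp_eq length_append)
      have "v @ t \<succ> v @ u" using rot[OF uv] prefix by simp
      then have "t @ v \<succ> u @ v" using len by (simp add: lex_gt_cancel lex_gt_extend)
      moreover have "v @ t \<succ> t @ v" using rot[OF prefix(2)] prefix uv by simp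
      ultimately show False using uv prefix lex_gt_asym by metis
    next
      case differ
      from differ[of u "[]"] rot[OF uv] lex_gt_asym show False by auto
    qed
  qed
next
  assume w: "w \<in> words_on Z \<and> (\<forall>u v. w = u @ v \<longrightarrow> u \<noteq> [] \<longrightarrow> v \<noteq> [] \<longrightarrow> w \<succ> v)"
  have "u @ v \<succ> v @ u" if "w = u @ v" "u \<noteq> []" "v \<noteq> []" for u v
  proof -
    from w that have "u @ v \<succ> v" by blast
    then show ?thesis using lex_gt_extend[of "u @ v" v "[]" u] by simp
  qed
  then show "w \<in> ALSW gt Z" using w by (simp add: ALSW_def)
qed

lemma ALSW_suffix: "u @ v \<in> ALSW gt Z \<Longrightarrow> u \<noteq> [] \<Longrightarrow> v \<noteq> [] \<Longrightarrow> u @ v \<succ> v"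
  by (auto simp: ALSW_iff_greater_than_suffixes)

lemma ALSW_words: "u \<in> ALSW gt Z \<Longrightarrow> u \<noteq> [] \<and> set u \<subseteq> Z"
  by (auto simp: ALSW_def words_on_def)

lemma letter_in_ALSW: "z \<in> Z \<Longrightarrow> [z] \<in> ALSW gt Z"
  by (auto simp: ALSW_def words_on_def Cons_eq_append_conv)

lemma ALSW_append:
  assumes u: "u \<in> ALSW gt Z" and v: "v \<in> ALSW gt Z" and uv: "u \<succ> v"
  shows "u @ v \<in> ALSW gt Z"
proof -
  have 1: "u @ v \<succ> v"
    using uv
  proof (cases rule: lex_gt_cases)
    case (prefix x)
    then have "v \<succ> x" using ALSW_suffix[of u x] v u ALSW_words by metis
    then show ?thesis using prefix lex_gt_cancel by metis
  next
    case differ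
    from differ[of v "[]"] show ?thesis by simp
  qed
  have "u @ v \<succ> s" if s: "u @ v = p @ s" "p \<noteq> []" "s \<noteq> []" for p s
  proof -
    consider (shorter) q where "q \<noteq> []" "v = q @ s" | (equal) "s = v"
      | (longer) x where "x \<noteq> []" "u = p @ x" "s = x @ v"
      using s by (auto simp: append_eq_append_conv2)
    then show ?thesis
    proof cases
      case shorter
      then have "v \<succ> s" using ALSW_suffix[of q s] v s by simp
      then show ?thesis using 1 lex_gt_trans by blast
    next
      case longer
      then have "u \<succ> x" "length x \<le> length u" using ALSW_suffix[of p x] u s by auto
      then show ?thesis unfolding longer(3) by (rule lex_gt_extend)
    qed (use 1 in simp)
  qed
  then show ?thesis using ALSW_words[OF u] ALSW_words[OF v]
    unfolding ALSW_iff_greater_than_suffixes words_on_def by simp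
qed

lemma is_NLSW_ALSW: "is_NLSW gt Z t \<Longrightarrow> assoc_word t \<in> ALSW gt Z"
  by (cases t) auto

text \<open>
  The condition \<open>v\<^sub>2 \<le> w\<close> in the definition of the bracketing makes the right factor \<open>w\<close> the greatest
  proper suffix: a suffix \<open>x'w\<close> that reaches into the left factor is less than \<open>x'\<close>, which inductively is at
  most \<open>v\<^sub>2\<close>. So the word determines both factors, and with them the bracketing.
\<close>

lemma is_NLSW_right_greatest:
  assumes "is_NLSW gt Z (Br s t)" "assoc_word (Br s t) = x @ y" "x \<noteq> []" "y \<noteq> []"
  shows "y = assoc_word t \<or> assoc_word t \<succ> y"
  using assms
proof (induction s arbitrary: t x y)
  case (Leaf z)
  then have t: "assoc_word t = tl x @ y" by (cases x) auto
  moreover have "assoc_word t \<in> ALSW gt Z" using Leaf.prems(1) is_NLSW_ALSW by simp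
  ultimately show ?case using ALSW_suffix[of "tl x" y] Leaf.prems(4) by (cases "tl x = []") auto
next
  case (Br s1 s2)
  let ?s = "assoc_word (Br s1 s2)" and ?t = "assoc_word t"
  have "?s @ ?t = x @ y" using Br.prems(2) by simp
  then consider (shorter) q where "q \<noteq> []" "?t = q @ y" | (equal) "y = ?t"
    | (longer) x' where "x' \<noteq> []" "?s = x @ x'" "y = x' @ ?t"
    unfolding append_eq_append_conv2 by fastforce
  then show ?case
  proof cases
    case shorter
    moreover have "?t \<in> ALSW gt Z" using Br.prems(1) is_NLSW_ALSW by simp
    ultimately show ?thesis using ALSW_suffix[of q y] Br.prems(4) by simp
  next
    case longer
    have "x' = assoc_word s2 \<or> assoc_word s2 \<succ> x'"
      using Br.IH(1)[of s2 x x'] Br.prems longer by auto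
    moreover have "assoc_word s2 = ?t \<or> ?t \<succ> assoc_word s2"
      using Br.prems by auto
    ultimately have "x' = ?t \<or> ?t \<succ> x'" using lex_gt_trans by metis
    moreover have "x' \<succ> x' @ ?t" using prefix_lex_gt assoc_word_nonempty by blast
    ultimately show ?thesis using longer lex_gt_trans by metis
  qed simp
qed

lemma is_NLSW_unique:
  assumes "is_NLSW gt Z s" "is_NLSW gt Z t" "assoc_word s = assoc_word t"
  shows "s = t"
  using assms
proof (induction s arbitrary: t)
  case (Leaf z)
  then show ?case
    by (cases t) (auto simp: assoc_word_nonempty Cons_eq_append_conv)
next
  case (Br s1 s2)
  show ?case
  proof (cases t)
    case (Leaf z)
    then show ?thesis using Br.prems
      by (auto simp: assoc_word_nonempty append_eq_Cons_conv)
  next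
    case t: (Br t1 t2)
    have "assoc_word s2 = assoc_word t2 \<or> assoc_word s2 \<succ> assoc_word t2"
      using is_NLSW_right_greatest[OF Br.prems(1)] Br.prems(3) t assoc_word_nonempty
      by (metis assoc_word.simps(2))
    moreover have "assoc_word t2 = assoc_word s2 \<or> assoc_word t2 \<succ> assoc_word s2"
      using is_NLSW_right_greatest[of t1 t2] Br.prems t assoc_word_nonempty
      by (metis assoc_word.simps(2))
    ultimately have "assoc_word s2 = assoc_word t2" using lex_gt_asym[of "assoc_word s2"] by auto
    then show ?thesis using Br t by auto
  qed
qed

text \<open>
  Conversely, cutting off the greatest proper suffix leaves a Lyndon-Shirshov word. This factorization gives
  the existence of the bracketing.
\<close>

lemma standard_factorization:
  assumes u: "u \<in> ALSW gt Z" and len: "length u \<ge> 2"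
  obtains v w where "u = v @ w" "v \<in> ALSW gt Z" "w \<in> ALSW gt Z"
    "\<And>x y. u = x @ y \<Longrightarrow> x \<noteq> [] \<Longrightarrow> y \<noteq> [] \<Longrightarrow> y = w \<or> w \<succ> y"
proof -
  have uZ: "set u \<subseteq> Z" using u ALSW_words by blast
  let ?S = "{y. y \<noteq> [] \<and> (\<exists>x. x \<noteq> [] \<and> u = x @ y)}"
  have fin: "finite ?S"
    by (rule finite_subset[of _ "set (suffixes u)"]) (auto simp: suffix_def)
  have "tl u \<in> ?S" using len by (cases u) (auto intro!: exI[of _ "[_]"])
  then have "?S \<noteq> {}" by blast
  moreover have "asymp_on ?S (\<lambda>a b. b \<succ> a)" by (intro asymp_onI lex_gt_asym)
  moreover have "transp_on ?S (\<lambda>a b. b \<succ> a)" by (rule transp_onI) (rule lex_gt_trans)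
  ultimately have "\<exists>w\<in>?S. \<forall>y\<in>?S. y \<noteq> w \<longrightarrow> \<not> y \<succ> w"
    using Finite_Set.bex_max_element[OF fin, of "\<lambda>a b. b \<succ> a"] by simp
  then obtain w where w_in: "w \<in> ?S" and w_max: "\<forall>y\<in>?S. y \<noteq> w \<longrightarrow> \<not> y \<succ> w" by (rule bexE)
  from w_in obtain v where vw: "u = v @ w" "v \<noteq> []" "w \<noteq> []" by blast
  have best: "y = w \<or> w \<succ> y" if "u = x @ y" "x \<noteq> []" "y \<noteq> []" for x y
  proof -
    have "set w \<subseteq> Z" "set y \<subseteq> Z" using uZ unfolding vw(1) by (simp, use uZ that(1) in simp)
    moreover have "y \<noteq> w \<longrightarrow> \<not> y \<succ> w" using w_max that by blast
    ultimately show ?thesis using lex_gt_total[of y w] by blast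
  qed
  have w: "w \<in> ALSW gt Z"
    unfolding ALSW_iff_greater_than_suffixes
  proof (intro conjI allI impI)
    fix p s assume p: "w = p @ s" "p \<noteq> []" "s \<noteq> []"
    have "s = w \<or> w \<succ> s" by (rule best[of "v @ p"]) (use p vw in simp_all)
    then show "w \<succ> s" using p by force
  qed (use vw uZ in \<open>auto simp: words_on_def\<close>)
  have v: "v \<in> ALSW gt Z"
    unfolding ALSW_iff_greater_than_suffixes
  proof (intro conjI allI impI)
    fix p x assume p: "v = p @ x" "p \<noteq> []" "x \<noteq> []"
    have u_gt: "v @ w \<succ> x @ w" using ALSW_suffix[of p "x @ w"] u p(2,3) unfolding vw(1) p(1) by simp
    show "v \<succ> x"
    proof (rule ccontr)
      assume "\<not> v \<succ> x"
      moreover have "v \<noteq> x" "set v \<subseteq> Z" "set x \<subseteq> Z" using p uZ unfolding vw(1) by auto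
      ultimately have "x \<succ> v" using lex_gt_total[of v x] by simp
      then show False
      proof (cases rule: lex_gt_cases)
        case (prefix v')
        have "v' @ w = w \<or> w \<succ> v' @ w" by (rule best[of x]) (use prefix p vw in simp_all)
        moreover have "v' @ w \<succ> w" using u_gt prefix lex_gt_cancel[of x "v' @ w" w] by simp
        ultimately show False using lex_gt_asym[of w "v' @ w"] lex_gt_irrefl[of w] by auto
      next
        case differ
        then show False using u_gt lex_gt_asym[of "v @ w" "x @ w"] by simp
      qed
    qed
  qed (use vw uZ in \<open>auto simp: words_on_def\<close>)
  show ?thesis by (rule that[OF vw(1) v w best])
qed

text \<open>
  If the right factor of the left part \<open>v\<close> were greater than \<open>w\<close>, then together with \<open>w\<close> it would
  give a proper suffix greater than \<open>w\<close>.
\<close>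

lemma is_NLSW_exists:
  "u \<in> ALSW gt Z \<Longrightarrow> \<exists>t. is_NLSW gt Z t \<and> assoc_word t = u"
proof (induction "length u" arbitrary: u rule: less_induct)
  case less
  show ?case
  proof (cases "length u \<ge> 2")
    case False
    then obtain z where "u = [z]" using ALSW_words[OF less.prems]
      by (cases u; cases "tl u") auto
    then show ?thesis using less.prems by (intro exI[of _ "Leaf z"]) auto
  next
    case True
    obtain v w where vw: "u = v @ w" "v \<in> ALSW gt Z" "w \<in> ALSW gt Z"
      and best: "\<And>x y. u = x @ y \<Longrightarrow> x \<noteq> [] \<Longrightarrow> y \<noteq> [] \<Longrightarrow> y = w \<or> w \<succ> y"
      using standard_factorization[OF less.prems True] by blast
    have ne: "v \<noteq> []" "w \<noteq> []" using vw ALSW_words by auto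
    from less.hyps vw ne obtain s t where st: "is_NLSW gt Z s" "assoc_word s = v"
      "is_NLSW gt Z t" "assoc_word t = w"
      by (metis add_less_cancel_left add_less_cancel_right add_0 add_0_right length_append length_greater_0_conv)
    have "assoc_word s2 = w \<or> w \<succ> assoc_word s2" if s: "s = Br s1 s2" for s1 s2
    proof (rule ccontr)
      let ?v1 = "assoc_word s1" and ?v2 = "assoc_word s2"
      assume "\<not> (?v2 = w \<or> w \<succ> ?v2)"
      then have "?v2 \<succ> w"
        using lex_gt_total[of ?v2 w] ALSW_words[OF vw(2)] ALSW_words[OF vw(3)] st s by auto
      then show False
      proof (cases rule: lex_gt_cases)
        case (prefix w')
        have "w \<succ> ?v2 @ w"
          using best[of ?v1 "?v2 @ w"] vw(1) st s assoc_word_nonempty by auto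
        then have "w' \<succ> w" using prefix lex_gt_cancel[of ?v2 w' w] by simp
        moreover have "w \<succ> w'" using ALSW_suffix[of ?v2 w'] vw prefix assoc_word_nonempty by auto
        ultimately show False using lex_gt_asym by blast
      next
        case differ
        have "w \<succ> ?v2 @ w"
          using best[of ?v1 "?v2 @ w"] vw(1) st s assoc_word_nonempty by auto
        then show False using differ[of w "[]"] lex_gt_asym by auto
      qed
    qed
    then have "is_NLSW gt Z (Br s t)" using st vw less.prems by auto
    then show ?thesis using st vw by (intro exI[of _ "Br s t"]) auto
  qed
qed

end

text \<open>
  In \<open>shirshov_bracketing\<close> the alphabet is the set of letters of the word itself; this transfers its
  bracketings to any larger alphabet and back.
\<close>

lemma is_NLSW_alphabet:
  "is_NLSW gt Y t \<Longrightarrow> set (assoc_word t) \<subseteq> Z \<Longrightarrow> is_NLSW gt Z t"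
  by (induction t) (auto simp: ALSW_def words_on_def)

context ordered_alphabet
begin

lemma shirshov_bracketing_eq:
  assumes "is_NLSW gt Z t"
  shows "shirshov_bracketing gt (assoc_word t) = t"
  unfolding shirshov_bracketing_def NLSW_def
proof (rule the_equality)
  show "t \<in> {t'. is_NLSW gt (set (assoc_word t)) t'} \<and> assoc_word t = assoc_word t"
    using assms is_NLSW_alphabet by auto
next
  fix s assume "s \<in> {t'. is_NLSW gt (set (assoc_word t)) t'} \<and> assoc_word s = assoc_word t"
  moreover have "set (assoc_word t) \<subseteq> Z" using assms is_NLSW_ALSW ALSW_words by blast
  ultimately show "s = t" using assms is_NLSW_unique[of s t] is_NLSW_alphabet[of gt _ s Z] by auto
qed

lemma shirshov_bracketing:
  assumes "u \<in> ALSW gt Z"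
  shows "is_NLSW gt Z (shirshov_bracketing gt u)" "assoc_word (shirshov_bracketing gt u) = u"
  using is_NLSW_exists[OF assms] shirshov_bracketing_eq by auto

end

section \<open>Brackets of Lyndon-Shirshov words in a Lie algebra\<close>

text \<open>
  The map \<open>commutator_value\<close> with an arbitrary product in place of the commutator.
\<close>

primrec lie_value :: "('v \<Rightarrow> 'v \<Rightarrow> 'v) \<Rightarrow> 'v nword \<Rightarrow> 'v" where
  "lie_value br (Leaf v) = v"
| "lie_value br (Br s t) = br (lie_value br s) (lie_value br t)"

context lie_omega_algebra
begin

lemma L_zero: "0 \<in> L" using subspace_L by (rule subspace_0)
lemma L_add: "x \<in> L \<Longrightarrow> y \<in> L \<Longrightarrow> x + y \<in> L" using subspace_L by (rule subspace_add)
lemma L_scale: "x \<in> L \<Longrightarrow> scale c x \<in> L" using subspace_L by (rule subspace_scale)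

lemma br_zero_left: "y \<in> L \<Longrightarrow> br 0 y = 0"
  using br_scale_left[of 0 y 0] L_zero by simp

lemma br_antisym:
  assumes "x \<in> L" "y \<in> L" shows "br x y = - br y x"
proof -
  have "br (x + y) (x + y) = br x x + br y x + (br x y + br y y)"
    using assms by (simp only: br_add_left br_add_right L_add)
  then have "br x y + br y x = 0"
    using assms br_self L_add by (simp add: add.commute)
  then show ?thesis by (simp add: eq_neg_iff_add_eq_0)
qed

lemma br_br_left:
  assumes "x \<in> L" "y \<in> L" "z \<in> L"
  shows "br (br x y) z = br (br x z) y + br x (br y z)"
proof -
  have "br (br x y) z = - br z (br x y)" "br (br x z) y = - br y (br x z)"
    using assms br_antisym br_closed by blast+
  moreover have "br y (br x z) = - br y (br z x)"
    using br_scale_right[of y "br z x" "-1"] br_antisym[of x z] assms br_closed by simp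
  moreover have "br z (br x y) = - (br x (br y z) + br y (br z x))"
    using jacobi[OF assms] by (metis eq_neg_iff_add_eq_0 add.commute)
  ultimately show ?thesis by simp
qed

lemma span_subset_L: "S \<subseteq> L \<Longrightarrow> span S \<subseteq> L"
  by (rule span_minimal[OF _ subspace_L])

text \<open>
  The product is linear on \<open>L\<close> only, so the linear span argument is carried out inside \<open>L\<close>.
\<close>

lemma br_left_in_span:
  assumes "S \<subseteq> L" "y \<in> L" "\<And>s. s \<in> S \<Longrightarrow> br s y \<in> span T" "x \<in> span S"
  shows "br x y \<in> span T"
proof -
  have "x \<in> {x \<in> L. br x y \<in> span T}"
  proof (rule subsetD[OF span_minimal assms(4)])
    show "subspace {x \<in> L. br x y \<in> span T}"
      by (rule subspaceI)
        (use assms(2) in \<open>auto simp: br_zero_left br_add_left br_scale_left L_zero L_add L_scale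
          span_zero span_add span_scale\<close>)
  qed (use assms in blast)
  then show ?thesis by simp
qed

lemma br_right_in_span:
  assumes "S \<subseteq> L" "y \<in> L" "\<And>s. s \<in> S \<Longrightarrow> br y s \<in> span T" "x \<in> span S"
  shows "br y x \<in> span T"
proof -
  have "br x y \<in> span T"
    using assms br_left_in_span[of S y T x] br_antisym span_neg by (metis in_mono)
  then show ?thesis
    using br_antisym[of y x] assms span_subset_L span_neg by (metis in_mono)
qed

lemma br_span_closed:
  assumes "S \<subseteq> L" "\<And>s t. s \<in> S \<Longrightarrow> t \<in> S \<Longrightarrow> br s t \<in> span S" "x \<in> span S" "y \<in> span S"
  shows "br x y \<in> span S"
proof (rule br_left_in_span[OF assms(1) _ _ assms(3)])
  show "y \<in> L" using assms span_subset_L by blast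
  show "br s y \<in> span S" if "s \<in> S" for s
    using br_right_in_span[OF assms(1) _ _ assms(4)] assms that by blast
qed

lemma opr_zero:
  assumes "\<omega> \<in> \<Omega>" "length xs = ar \<omega>" "set xs \<subseteq> L" "i < ar \<omega>"
  shows "opr \<omega> (xs[i := 0]) = 0"
  using opr_scale[OF assms L_zero, of 0] by simp

text \<open>
  Multilinearity is applied one argument at a time: the induction is on the number \<open>k\<close> of leading
  arguments that are arbitrary elements of the span, all later ones being in \<open>S\<close>.
\<close>

lemma opr_span_closed:
  assumes S: "S \<subseteq> L" and \<omega>: "\<omega> \<in> \<Omega>"
    and on_S: "\<And>xs. length xs = ar \<omega> \<Longrightarrow> set xs \<subseteq> S \<Longrightarrow> opr \<omega> xs \<in> span S"
    and xs: "length xs = ar \<omega>" "set xs \<subseteq> span S"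
  shows "opr \<omega> xs \<in> span S"
proof -
  have "opr \<omega> xs \<in> span S"
    if "length xs = ar \<omega>" "set xs \<subseteq> span S" "k \<le> ar \<omega>" "set (drop k xs) \<subseteq> S" for k xs
    using that
  proof (induction k arbitrary: xs)
    case 0
    then show ?case using on_S by simp
  next
    case (Suc k)
    then have k: "k < length xs" by simp
    have xsL: "set xs \<subseteq> L" using Suc.prems S span_subset_L by blast
    let ?M = "{x \<in> L. opr \<omega> (xs[k := x]) \<in> span S}"
    have "xs ! k \<in> ?M"
    proof (rule subsetD[OF span_minimal[of S ?M]])
      show "subspace ?M"
        by (rule subspaceI)
          (use \<omega> Suc.prems xsL in \<open>auto simp: opr_zero opr_add opr_scale L_zero L_add L_scale
            span_zero span_add span_scale\<close>)
      show "S \<subseteq> ?M"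
      proof
        fix s assume s: "s \<in> S"
        have "opr \<omega> (xs[k := s]) \<in> span S"
        proof (rule Suc.IH)
          have "drop k (xs[k := s]) = s # drop (Suc k) xs"
            using k by (simp add: drop_update_swap flip: Cons_nth_drop_Suc)
          then show "set (drop k (xs[k := s])) \<subseteq> S" using s Suc.prems by simp
          show "set (xs[k := s]) \<subseteq> span S"
            using Suc.prems s span_base set_update_subset_insert[of xs k s] by blast
        qed (use Suc.prems in auto)
        then show "s \<in> ?M" using s S by blast
      qed
      show "xs ! k \<in> span S" using Suc.prems k by auto
    qed
    then show ?case by simp
  qed
  from this[of xs "ar \<omega>"] xs show ?thesis by simp
qed

end

lemma (in lie_omega_algebra) subalgebra_lie_omega_algebra:
  assumes "lie_omega_subalgebra scale \<Omega> ar L br opr M"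
  shows "lie_omega_algebra scale \<Omega> ar M br opr"
proof -
  have M: "M \<subseteq> L" "subspace M" "\<And>x y. x \<in> M \<Longrightarrow> y \<in> M \<Longrightarrow> br x y \<in> M"
    "\<And>\<omega> xs. \<omega> \<in> \<Omega> \<Longrightarrow> length xs = ar \<omega> \<Longrightarrow> set xs \<subseteq> M \<Longrightarrow> opr \<omega> xs \<in> M"
    using assms unfolding lie_omega_subalgebra_def by blast+
  show ?thesis
  proof unfold_locales
    fix x y z c assume "x \<in> M" "y \<in> M" "z \<in> M"
    then have "x \<in> L" "y \<in> L" "z \<in> L" using M(1) by blast+
    then show "br (x + y) z = br x z + br y z" "br x (y + z) = br x y + br x z"
      "br x (br y z) + br y (br z x) + br z (br x y) = 0"
      using br_add_left br_add_right jacobi by blast+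
  next
    fix x y c assume "x \<in> M" "y \<in> M"
    then have "x \<in> L" "y \<in> L" using M(1) by blast+
    then show "br (scale c x) y = scale c (br x y)" "br x (scale c y) = scale c (br x y)"
      using br_scale_left br_scale_right by blast+
  next
    show "br x x = 0" if "x \<in> M" for x using that M(1) br_self by blast
  next
    fix \<omega> xs i x y
    assume *: "\<omega> \<in> \<Omega>" "length xs = ar \<omega>" "set xs \<subseteq> M" "i < ar \<omega>" "x \<in> M" "y \<in> M"
    show "opr \<omega> (xs[i := x + y]) = opr \<omega> (xs[i := x]) + opr \<omega> (xs[i := y])"
      by (rule opr_add) (use * M(1) in auto)
  next
    fix \<omega> xs i x c
    assume *: "\<omega> \<in> \<Omega>" "length xs = ar \<omega>" "set xs \<subseteq> M" "i < ar \<omega>" "x \<in> M"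
    show "opr \<omega> (xs[i := scale c x]) = scale c (opr \<omega> (xs[i := x]))"
      by (rule opr_scale) (use * M(1) in auto)
  qed (use M in auto)
qed

lemma lie_value_in:
  assumes "\<And>x y. x \<in> M \<Longrightarrow> y \<in> M \<Longrightarrow> br x y \<in> M" "e ` set (assoc_word t) \<subseteq> M"
  shows "lie_value br (map_nword e t) \<in> M"
  using assms(2) by (induction t) (auto intro: assms(1))

locale lyndon_values = lie_omega_algebra scale \<Omega> ar L br opr + ordered_alphabet gt Z
  for scale :: "'k::field \<Rightarrow> 'v::ab_group_add \<Rightarrow> 'v" and \<Omega> :: "'o set" and ar L br opr
    and gt :: "'z \<Rightarrow> 'z \<Rightarrow> bool" and Z +
  fixes e :: "'z \<Rightarrow> 'v"
  assumes letters_in_L: "e ` Z \<subseteq> L"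
begin

definition val :: "'z list \<Rightarrow> 'v" where
  "val u = lie_value br (map_nword e (shirshov_bracketing gt u))"

lemma val_in_L: "u \<in> ALSW gt Z \<Longrightarrow> val u \<in> L"
  unfolding val_def using letters_in_L ALSW_words[of u]
  by (intro lie_value_in br_closed) (auto simp: shirshov_bracketing)

lemma val_Br:
  assumes "is_NLSW gt Z (Br s t)"
  shows "val (assoc_word (Br s t)) = br (val (assoc_word s)) (val (assoc_word t))"
  using assms unfolding val_def by (simp add: shirshov_bracketing_eq del: assoc_word.simps)

text \<open>
  The words that may occur when the product of \<open>[l]\<close> and \<open>[m]\<close> is expanded. The alphabet is cut
  down to a finite set \<open>A\<close> to have only finitely many of them.
\<close>

definition above :: "'z set \<Rightarrow> nat \<Rightarrow> 'z list \<Rightarrow> 'z list set" where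
  "above A N m = {n \<in> ALSW gt Z. length n = N \<and> n \<succ> m \<and> set n \<subseteq> A}"

text \<open>
  The outer induction is on the total length of the two words. For a fixed length the inner induction
  increases the smaller word \<open>m\<close>; it is well-founded because only finitely many words over \<open>A\<close> of
  bounded length exceed \<open>m\<close>. If \<open>[l] = [x][y]\<close> with \<open>y > m\<close>, the Jacobi identity gives
  \<open>[[x][y]][m] = [[x][m]][y] + [x][[y][m]]\<close>. The outer hypothesis expands the inner products into words greater
  than \<open>m\<close>, and the remaining products have both factors greater than \<open>m\<close>, so that the inner hypothesis applies.
\<close>

lemma br_val_in_span_above:
  assumes A: "finite A" "A \<subseteq> Z"
    and lm: "l \<in> ALSW gt Z" "m \<in> ALSW gt Z" "set l \<subseteq> A" "set m \<subseteq> A" "l \<succ> m"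
  shows "br (val l) (val m) \<in> span (val ` above A (length l + length m) m)"
  using lm
proof (induction "length l + length m" arbitrary: l m rule: less_induct)
  case outer: (less l m)
  define N where "N = length l + length m"
  let ?K = "\<lambda>m. {n. set n \<subseteq> A \<and> length n \<le> N \<and> n \<succ> m}"
  have finK: "finite (?K m)" for m
    by (rule finite_subset[OF _ finite_lists_length_le[OF A(1), of N]]) auto
  have "br (val l) (val m) \<in> span (val ` above A N m)"
    if "length l + length m = N" "l \<in> ALSW gt Z" "m \<in> ALSW gt Z" "set l \<subseteq> A" "set m \<subseteq> A" "l \<succ> m"
    for l m
    using that
  proof (induction "card (?K m)" arbitrary: l m rule: less_induct)
    case less
    \<comment> \<open>Two factors that both exceed \<open>m\<close> are covered by the inner hypothesis, whichever of them is smaller.\<close>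
    have larger: "br (val p) (val q) \<in> span (val ` above A N m)"
      if pq: "length p + length q = N" "p \<in> ALSW gt Z" "q \<in> ALSW gt Z" "set p \<subseteq> A" "set q \<subseteq> A"
        "p \<succ> m" "q \<succ> m" for p q
    proof -
      have *: "br (val p) (val q) \<in> span (val ` above A N m)"
        if pq: "length p + length q = N" "p \<in> ALSW gt Z" "q \<in> ALSW gt Z" "set p \<subseteq> A" "set q \<subseteq> A"
          "p \<succ> m" "q \<succ> m" "p \<succ> q" for p q
      proof -
        have "q \<in> ?K m" "q \<notin> ?K q" using pq lex_gt_irrefl[of q] by auto
        moreover have "?K q \<subseteq> ?K m" using lex_gt_trans[of _ q m] pq by auto
        ultimately have "?K q \<subset> ?K m" by blast
        then have "card (?K q) < card (?K m)" by (rule psubset_card_mono[OF finK])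
        then have "br (val p) (val q) \<in> span (val ` above A N q)" using less.hyps pq by blast
        moreover have "above A N q \<subseteq> above A N m"
          unfolding above_def using lex_gt_trans[of _ q m] pq by auto
        ultimately show ?thesis using span_mono image_mono by (metis in_mono)
      qed
      consider "p = q" | "p \<succ> q" | "q \<succ> p"
        using lex_gt_total[of p q] pq A by auto
      then show ?thesis
      proof cases
        case 1
        then show ?thesis using br_self[OF val_in_L[OF pq(2)]] span_zero by simp
      next
        case 2
        then show ?thesis using * pq by blast
      next
        case 3
        then have "br (val q) (val p) \<in> span (val ` above A N m)" using *[of q p] pq by auto
        then show ?thesis using br_antisym val_in_L pq span_neg by metis
      qed
    qed
    define s t where "s = shirshov_bracketing gt l" and "t = shirshov_bracketing gt m"
    have s: "is_NLSW gt Z s" "assoc_word s = l" and t: "is_NLSW gt Z t" "assoc_word t = m"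
      unfolding s_def t_def using shirshov_bracketing less.prems by blast+
    have lm: "l @ m \<in> ALSW gt Z" "l @ m \<succ> m"
      using ALSW_append[of l m] ALSW_suffix[of l m] ALSW_words less.prems by auto
    show ?case
    proof (cases "is_NLSW gt Z (Br s t)")
      case True
      have "l @ m \<in> above A N m" using lm less.prems by (auto simp: above_def)
      moreover have "br (val l) (val m) = val (l @ m)" using val_Br[OF True] s t by simp
      ultimately show ?thesis using span_base by (metis imageI)
    next
      case False
      then obtain a b where ab: "s = Br a b"
        and not_le: "\<not> (assoc_word b = m \<or> m \<succ> assoc_word b)"
        using s t lm by auto
      define x y where "x = assoc_word a" and "y = assoc_word b"
      have xy: "l = x @ y" "x \<in> ALSW gt Z" "y \<in> ALSW gt Z" "x \<noteq> []" "y \<noteq> []"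
        and val_l: "val l = br (val x) (val y)"
        using s ab val_Br[of a b] is_NLSW_ALSW assoc_word_nonempty by (auto simp: x_def y_def)
      have xyA: "set x \<subseteq> A" "set y \<subseteq> A" using xy less.prems by auto
      \<comment> \<open>If the bracketing fails to be standard, the right factor \<open>y\<close> of \<open>l\<close> is greater than \<open>m\<close>.\<close>
      have ym: "y \<succ> m"
        using not_le lex_gt_total[of y m] xyA less.prems A by (auto simp: y_def)
      have xm: "x \<succ> m"
        using prefix_lex_gt[OF xy(5), of x] less.prems xy lex_gt_trans by metis
      have in_L: "val x \<in> L" "val y \<in> L" "val m \<in> L" using val_in_L xy less.prems by auto
      have sub_L: "val ` above A n m \<subseteq> L" for n using val_in_L by (auto simp: above_def)
      have shorter: "length x + length m < N" "length y + length m < N"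
        using less.prems xy by auto
      have "br (br (val x) (val m)) (val y) \<in> span (val ` above A N m)"
      proof (rule br_left_in_span[OF sub_L in_L(2)])
        show "br (val x) (val m) \<in> span (val ` above A (length x + length m) m)"
          using outer.hyps[of x m] shorter N_def xy xyA less.prems xm by metis
        show "br v (val y) \<in> span (val ` above A N m)"
          if "v \<in> val ` above A (length x + length m) m" for v
          using that larger xy xyA ym less.prems by (auto simp: above_def)
      qed
      moreover have "br (val x) (br (val y) (val m)) \<in> span (val ` above A N m)"
      proof (rule br_right_in_span[OF sub_L in_L(1)])
        show "br (val y) (val m) \<in> span (val ` above A (length y + length m) m)"
          using outer.hyps[of y m] shorter N_def xy xyA less.prems ym by metis
        show "br (val x) v \<in> span (val ` above A N m)"
          if "v \<in> val ` above A (length y + length m) m" for v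
          using that larger xy xyA xm less.prems by (auto simp: above_def)
      qed
      ultimately show ?thesis
        unfolding val_l br_br_left[OF in_L] by (rule span_add)
    qed
  qed
  then show ?case using outer.prems unfolding N_def by blast
qed

lemma br_val_in_span:
  assumes u: "u \<in> ALSW gt Z" and v: "v \<in> ALSW gt Z"
  shows "br (val u) (val v) \<in> span (val ` ALSW gt Z)"
proof -
  have *: "br (val l) (val m) \<in> span (val ` ALSW gt Z)"
    if "l \<in> ALSW gt Z" "m \<in> ALSW gt Z" "l \<succ> m" for l m
    using br_val_in_span_above[of "set l \<union> set m" l m] that ALSW_words[of l] ALSW_words[of m]
      span_mono[of "val ` above (set l \<union> set m) (length l + length m) m" "val ` ALSW gt Z"]
    by (auto simp: above_def)
  consider "u = v" | "u \<succ> v" | "v \<succ> u"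
    using lex_gt_total[of u v] ALSW_words u v by blast
  then show ?thesis
  proof cases
    case 1
    then show ?thesis using br_self val_in_L u span_zero by metis
  next
    case 3
    then show ?thesis using * u v br_antisym val_in_L span_neg by metis
  qed (use * u v in blast)
qed

lemma span_val_closed:
  "x \<in> span (val ` ALSW gt Z) \<Longrightarrow> y \<in> span (val ` ALSW gt Z) \<Longrightarrow> br x y \<in> span (val ` ALSW gt Z)"
  by (rule br_span_closed) (use val_in_L br_val_in_span in auto)

end

section \<open>The order on \<open>\<Omega>\<close>-words\<close>

text \<open>
  The lexicographic comparison of tuples that occurs, written out, in the definition of
  \<open>prime_gt\<close> and \<open>Dl_gt\<close>. Unlike \<open>lex_gt\<close> it never makes a proper prefix comparable.
\<close>

definition first_diff :: "('z \<Rightarrow> 'z \<Rightarrow> bool) \<Rightarrow> 'z list \<Rightarrow> 'z list \<Rightarrow> bool" where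
  "first_diff gt xs ys \<longleftrightarrow> (\<exists>cs a as b bs. xs = cs @ a # as \<and> ys = cs @ b # bs \<and> gt a b)"

lemma first_diff_Nil [simp]: "\<not> first_diff gt [] ys" "\<not> first_diff gt xs []"
  by (auto simp: first_diff_def)

lemma first_diff_Cons [simp]:
  "first_diff gt (x # xs) (y # ys) \<longleftrightarrow> gt x y \<or> x = y \<and> first_diff gt xs ys"
proof
  assume "first_diff gt (x # xs) (y # ys)"
  then obtain cs a as b bs where *: "x # xs = cs @ a # as" "y # ys = cs @ b # bs" "gt a b"
    by (auto simp: first_diff_def)
  then show "gt x y \<or> x = y \<and> first_diff gt xs ys"
    by (cases cs) (auto simp: first_diff_def)
next
  assume "gt x y \<or> x = y \<and> first_diff gt xs ys"
  then show "first_diff gt (x # xs) (y # ys)"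
  proof
    assume "gt x y"
    then show ?thesis unfolding first_diff_def by (intro exI[of _ "[]"]) auto
  next
    assume "x = y \<and> first_diff gt xs ys"
    then show ?thesis unfolding first_diff_def by (metis append_Cons)
  qed
qed

lemma first_diff_irrefl: "(\<And>a. a \<in> set xs \<Longrightarrow> \<not> gt a a) \<Longrightarrow> \<not> first_diff gt xs xs"
  by (induction xs) auto

text \<open>
  Transitivity is assumed only for entries of the first tuple, as the induction over prime words supplies it.
\<close>

lemma first_diff_trans:
  assumes "\<And>a b c. a \<in> set xs \<Longrightarrow> gt a b \<Longrightarrow> gt b c \<Longrightarrow> gt a c"
    "first_diff gt xs ys" "first_diff gt ys zs"
  shows "first_diff gt xs zs"
  using assms
proof (induction xs arbitrary: ys zs)
  case (Cons x xs)
  obtain y ys' where ys: "ys = y # ys'" using Cons.prems by (cases ys) auto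
  obtain z zs' where zs: "zs = z # zs'" using Cons.prems by (cases zs) auto
  have "gt x y \<or> x = y \<and> first_diff gt xs ys'" "gt y z \<or> y = z \<and> first_diff gt ys' zs'"
    using Cons.prems ys zs by auto
  moreover have "gt x y \<Longrightarrow> gt y z \<Longrightarrow> gt x z" using Cons.prems(1) by simp
  moreover have "first_diff gt xs ys' \<Longrightarrow> first_diff gt ys' zs' \<Longrightarrow> first_diff gt xs zs'"
    using Cons.IH Cons.prems(1) by (meson list.set_intros(2))
  ultimately show ?case unfolding zs by auto
qed simp

lemma first_diff_total:
  assumes "length xs = length ys"
    "\<And>a b. a \<in> set xs \<Longrightarrow> b \<in> set ys \<Longrightarrow> a = b \<or> gt a b \<or> gt b a"
  shows "xs = ys \<or> first_diff gt xs ys \<or> first_diff gt ys xs"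
  using assms by (induction xs ys rule: list_induct2) auto

lemma lex_gt_iff_first_diff: "length u = length v \<Longrightarrow> lex_gt gt u v \<longleftrightarrow> first_diff gt u v"
  by (induction u v rule: list_induct2) auto

lemma first_diff_pointwise:
  "list_all2 (\<lambda>x y. y = x \<or> gt x y) xs ys \<Longrightarrow> ys = xs \<or> first_diff gt xs ys"
  by (induction xs ys rule: list_all2_induct) auto

lemma Dl_gt_iff:
  "Dl_gt u v \<longleftrightarrow> deg u > deg v \<or> deg u = deg v \<and>
     (length u > length v \<or> length u = length v \<and> first_diff prime_gt u v)"
proof
  assume "Dl_gt u v"
  then show "deg u > deg v \<or> deg u = deg v \<and>
     (length u > length v \<or> length u = length v \<and> first_diff prime_gt u v)"
    by cases (auto simp: first_diff_def)
qed (auto simp: first_diff_def intro: prime_gt_Dl_gt.intros)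

lemma prime_gt_Op_iff:
  "prime_gt (Op \<omega> us) (Op \<theta> vs) \<longleftrightarrow> prime_deg (Op \<omega> us) > prime_deg (Op \<theta> vs) \<or>
     prime_deg (Op \<omega> us) = prime_deg (Op \<theta> vs) \<and> (\<omega> > \<theta> \<or> \<omega> = \<theta> \<and> first_diff Dl_gt us vs)"
  (is "?l \<longleftrightarrow> ?r")
proof
  assume ?l
  then show ?r by cases (auto simp: first_diff_def simp del: prime_deg.simps)
qed (auto simp: first_diff_def simp del: prime_deg.simps intro: prime_gt_Dl_gt.intros)

lemma prime_gt_Var_iff: "prime_gt (Var x) (Var y) \<longleftrightarrow> x > y"
  by (auto elim: prime_gt.cases intro: prime_gt_Dl_gt.intros)

lemma prime_gt_mixed_iff:
  "\<not> prime_gt (Var x) (Op \<omega> us)"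
  "prime_gt (Op \<omega> us) (Var x) \<longleftrightarrow> prime_deg (Op \<omega> us) > 1"
  by (auto elim: prime_gt.cases intro: prime_gt_Dl_gt.intros)

lemma prime_gt_deg: "prime_gt p q \<Longrightarrow> prime_deg p \<ge> prime_deg q"
  by (erule prime_gt.cases) auto

lemma succ_gt_eq_prime_gt: "succ_gt = prime_gt"
  by (intro ext) (auto simp: succ_gt_def Dl_gt_iff deg_def intro: prime_gt_Dl_gt.intros dest: prime_gt_deg)

lemma prime_gt_irrefl: "\<not> prime_gt p p"
proof (induction p)
  case (Op \<omega> us)
  then have "\<not> first_diff prime_gt u u" if "u \<in> set us" for u
    using that by (intro first_diff_irrefl) blast
  then have "\<not> first_diff Dl_gt us us"
    by (intro first_diff_irrefl) (simp add: Dl_gt_iff)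
  then show ?case by (simp add: prime_gt_Op_iff)
qed (simp add: prime_gt_Var_iff)

lemma Dl_gt_trans_if:
  assumes "\<And>p q r. p \<in> set u \<Longrightarrow> prime_gt p q \<Longrightarrow> prime_gt q r \<Longrightarrow> prime_gt p r"
    "Dl_gt u v" "Dl_gt v w"
  shows "Dl_gt u w"
  using assms(2,3) first_diff_trans[of u prime_gt v w, OF assms(1)] unfolding Dl_gt_iff by auto

text \<open>
  Structural induction on the first word suffices, since comparing arguments only
  involves prime words occurring in it.
\<close>

lemma prime_gt_trans: "prime_gt p q \<Longrightarrow> prime_gt q r \<Longrightarrow> prime_gt p r"
proof (induction p arbitrary: q r)
  case (Var x)
  then show ?case
    by (cases q; cases r) (auto simp: prime_gt_Var_iff prime_gt_mixed_iff simp del: prime_deg.simps)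
next
  case (Op \<omega> us)
  have fd: "first_diff Dl_gt us ws" if "first_diff Dl_gt us vs" "first_diff Dl_gt vs ws" for vs ws
    using first_diff_trans[OF _ that] Dl_gt_trans_if Op.IH by metis
  show ?case
  proof (cases q)
    case q: (Var y)
    then show ?thesis using Op.prems
      by (cases r) (auto simp: prime_gt_mixed_iff simp del: prime_deg.simps)
  next
    case q: (Op \<theta> vs)
    show ?thesis
    proof (cases r)
      case (Var z)
      then show ?thesis using Op.prems prime_gt_deg[OF Op.prems(1)] q
        by (auto simp: prime_gt_mixed_iff simp del: prime_deg.simps)
    next
      case r: (Op \<eta> ws)
      show ?thesis using Op.prems fd[of vs ws] unfolding q r prime_gt_Op_iff
        by (auto simp del: prime_deg.simps)
    qed
  qed
qed

lemma Dl_gt_irrefl: "\<not> Dl_gt u u"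
  using first_diff_irrefl[of u prime_gt] prime_gt_irrefl by (auto simp: Dl_gt_iff)

lemma Dl_gt_trans: "Dl_gt u v \<Longrightarrow> Dl_gt v w \<Longrightarrow> Dl_gt u w"
  using Dl_gt_trans_if prime_gt_trans by blast

section \<open>Lyndon-Shirshov \<open>\<Omega>\<close>-words\<close>

text \<open>
  Both hierarchies of words are unions of levels in which the words of the next level are those over the letters
  \<open>X \<union> \<Omega>(level n)\<close> that satisfy a condition \<open>Q\<close> independent of the alphabet. A word involves
  only finitely many prime words and these only finitely many arguments, so the union is a fixed point of this step.
  The fixed point turns statements about \<open>\<Omega>\<close>-words into statements about words over one alphabet.
\<close>

lemma words_levels_fixpoint:
  fixes W :: "('x, 'o) prime_word set \<Rightarrow> ('x, 'o) oword set"
  assumes W: "\<And>Y w. w \<in> W Y \<longleftrightarrow> set w \<subseteq> Y \<and> Q w"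
    and zero: "level 0 = W (Var ` X)"
    and Suc: "\<And>n. level (Suc n) = W (Var ` X \<union> op_words \<Omega> ar (level n))"
  shows "(\<Union>n. level n) = W (Var ` X \<union> op_words \<Omega> ar (\<Union>n. level n))"
proof -
  have op_mono: "op_words \<Omega> ar Y \<subseteq> op_words \<Omega> ar Y'" if "Y \<subseteq> Y'"
    for Y Y' :: "('x, 'o) oword set"
    using that by (auto simp: op_words_def)
  have W_mono: "W Y \<subseteq> W Y'" if "Y \<subseteq> Y'" for Y Y'
    using that W by blast
  have "level n \<subseteq> level (Suc n)" for n
  proof (induction n)
    case 0
    show ?case unfolding zero Suc by (rule W_mono) simp
  next
    case (Suc n)
    then show ?case unfolding assms(3) using W_mono op_mono by (meson Un_mono order_refl)
  qed
  then have level_mono: "level m \<subseteq> level n" if "m \<le> n" for m n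
    using that by (rule lift_Suc_mono_le)
  have bounded: "\<exists>n. A \<subseteq> B n" if "finite A" "A \<subseteq> (\<Union>n. B n)" "\<And>m n. m \<le> n \<Longrightarrow> B m \<subseteq> B n"
    for A and B :: "nat \<Rightarrow> 'y set"
    using that(1,2)
  proof (induction A)
    case (insert a A)
    then obtain m n where "A \<subseteq> B m" "a \<in> B n" by auto
    then have "insert a A \<subseteq> B (max m n)" using that(3)[of m "max m n"] that(3)[of n "max m n"] by auto
    then show ?case by blast
  qed simp
  show ?thesis
  proof
    have "level n \<subseteq> W (Var ` X \<union> op_words \<Omega> ar (\<Union>n. level n))" for n
    proof (cases n)
      case 0
      show ?thesis unfolding 0 zero by (rule W_mono) simp
    next
      case (Suc m)
      show ?thesis unfolding Suc assms(3)
        by (intro W_mono Un_mono op_mono) auto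
    qed
    then show "(\<Union>n. level n) \<subseteq> W (Var ` X \<union> op_words \<Omega> ar (\<Union>n. level n))" by blast
  next
    let ?P = "\<lambda>n. Var ` X \<union> op_words \<Omega> ar (level n)"
    have "op_words \<Omega> ar (\<Union>n. level n) \<subseteq> (\<Union>n. op_words \<Omega> ar (level n))"
    proof
      fix p assume "p \<in> op_words \<Omega> ar (\<Union>n. level n)"
      then obtain \<omega> us where p: "p = Op \<omega> us" "\<omega> \<in> \<Omega>" "length us = ar \<omega>" "set us \<subseteq> (\<Union>n. level n)"
        by (auto simp: op_words_def)
      then obtain n where "set us \<subseteq> level n" using bounded[of "set us" level] level_mono by auto
      then show "p \<in> (\<Union>n. op_words \<Omega> ar (level n))" using p by (auto simp: op_words_def)
    qed
    then have bounded_letters: "Var ` X \<union> op_words \<Omega> ar (\<Union>n. level n) \<subseteq> (\<Union>n. ?P n)" by auto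
    show "W (Var ` X \<union> op_words \<Omega> ar (\<Union>n. level n)) \<subseteq> (\<Union>n. level n)"
    proof
      fix w assume w: "w \<in> W (Var ` X \<union> op_words \<Omega> ar (\<Union>n. level n))"
      then have "set w \<subseteq> (\<Union>n. ?P n)" using bounded_letters unfolding W by (blast intro: order_trans)
      then obtain n where "set w \<subseteq> ?P n"
        using bounded[of "set w" ?P] op_mono[OF level_mono] by (meson List.finite_set Un_mono order_refl)
      then have "w \<in> level (Suc n)" using w unfolding Suc W by simp
      then show "w \<in> (\<Union>n. level n)" by blast
    qed
  qed
qed

definition prime_words :: "'x set \<Rightarrow> 'o set \<Rightarrow> ('o \<Rightarrow> nat) \<Rightarrow> ('x, 'o) prime_word set" where
  "prime_words X \<Omega> ar = Var ` X \<union> op_words \<Omega> ar (owords X \<Omega> ar)"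

definition ALSW_primes ::
  "'x::wellorder set \<Rightarrow> 'o::wellorder set \<Rightarrow> ('o \<Rightarrow> nat) \<Rightarrow> ('x, 'o) prime_word set" where
  "ALSW_primes X \<Omega> ar = Var ` X \<union> op_words \<Omega> ar (ALSW_op X \<Omega> ar)"

lemma owords_eq: "owords X \<Omega> ar = words_on (prime_words X \<Omega> ar)"
  unfolding owords_def prime_words_def
  by (rule words_levels_fixpoint[where Q = "\<lambda>w. w \<noteq> []"]) (auto simp: words_on_def)

lemma ALSW_op_eq: "ALSW_op X \<Omega> ar = ALSW succ_gt (ALSW_primes X \<Omega> ar)"
  unfolding ALSW_op_def ALSW_primes_def
  by (rule words_levels_fixpoint[where Q = "\<lambda>w. w \<noteq> [] \<and>
      (\<forall>u v. w = u @ v \<and> u \<noteq> [] \<and> v \<noteq> [] \<longrightarrow> lex_gt succ_gt (u @ v) (v @ u))"])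
    (auto simp: ALSW_def words_on_def)

lemma ALSW_op_subset_owords: "ALSW_op X \<Omega> ar \<subseteq> owords X \<Omega> ar"
proof -
  have "ALSW_level X \<Omega> ar n \<subseteq> owords_level X \<Omega> ar n" for n
  proof (induction n)
    case (Suc n)
    then have "op_words \<Omega> ar (ALSW_level X \<Omega> ar n) \<subseteq> op_words \<Omega> ar (owords_level X \<Omega> ar n)"
      by (auto simp: op_words_def)
    then show ?case by (auto simp: ALSW_def words_on_def)
  qed (auto simp: ALSW_def)
  then show ?thesis by (auto simp: ALSW_op_def owords_def)
qed

lemma ALSW_primes_subset: "ALSW_primes X \<Omega> ar \<subseteq> prime_words X \<Omega> ar"
  using ALSW_op_subset_owords[of X \<Omega> ar] by (auto simp: ALSW_primes_def prime_words_def op_words_def)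

lemma Op_in_prime_words:
  "Op \<omega> us \<in> prime_words X \<Omega> ar \<longleftrightarrow> \<omega> \<in> \<Omega> \<and> length us = ar \<omega> \<and> set us \<subseteq> owords X \<Omega> ar"
  by (auto simp: prime_words_def op_words_def)

lemma Op_in_ALSW_primes:
  "Op \<omega> us \<in> ALSW_primes X \<Omega> ar \<longleftrightarrow> \<omega> \<in> \<Omega> \<and> length us = ar \<omega> \<and> set us \<subseteq> ALSW_op X \<Omega> ar"
  by (auto simp: ALSW_primes_def op_words_def)

lemma prime_deg_pos: "prime_deg p \<ge> 1"
  by (cases p) auto

lemma prime_deg_Op_gt_1:
  assumes "us \<noteq> []" "[] \<notin> set us"
  shows "prime_deg (Op \<omega> us) > 1"
proof -
  obtain p u us' where "us = (p # u) # us'"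
    using assms by (cases us; cases "hd us") auto
  then show ?thesis using prime_deg_pos[of p] by simp
qed

text \<open>
  Positive arity and nonempty arguments are what separates letters from operator words: the latter
  then have degree at least 2. Equal arities make argument tuples comparable.
\<close>

lemma prime_gt_total:
  assumes ar: "\<And>\<omega>. \<omega> \<in> \<Omega> \<Longrightarrow> ar \<omega> \<ge> 1"
  shows "p \<in> prime_words X \<Omega> ar \<Longrightarrow> q \<in> prime_words X \<Omega> ar \<Longrightarrow> p = q \<or> prime_gt p q \<or> prime_gt q p"
proof (induction p arbitrary: q)
  have Op_deg: "prime_deg (Op \<omega> us) > 1" if "Op \<omega> us \<in> prime_words X \<Omega> ar" for \<omega> us
    using that ar[of \<omega>] by (intro prime_deg_Op_gt_1) (auto simp: Op_in_prime_words owords_eq words_on_def)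
  {
    case (Var x)
    then show ?case using Op_deg
      by (cases q) (auto simp: prime_gt_Var_iff prime_gt_mixed_iff simp del: prime_deg.simps)
  next
    case (Op \<omega> us)
    show ?case
    proof (cases q)
      case Var
      then show ?thesis using Op_deg Op.prems by (simp add: prime_gt_mixed_iff del: prime_deg.simps)
    next
      case q: (Op \<theta> vs)
      have words: "a = b \<or> Dl_gt a b \<or> Dl_gt b a" if "a \<in> set us" "b \<in> set vs" for a b
      proof -
        have "set a \<subseteq> prime_words X \<Omega> ar" "set b \<subseteq> prime_words X \<Omega> ar"
          using that Op.prems q by (auto simp: Op_in_prime_words owords_eq words_on_def)
        then have "c = d \<or> prime_gt c d \<or> prime_gt d c" if "c \<in> set a" "d \<in> set b" for c d
          using Op.IH[OF \<open>a \<in> set us\<close> that(1)] that by blast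
        then have "a = b \<or> first_diff prime_gt a b \<or> first_diff prime_gt b a" if "length a = length b"
          using that by (intro first_diff_total)
        then show ?thesis unfolding Dl_gt_iff by fastforce
      qed
      have "us = vs \<or> first_diff Dl_gt us vs \<or> first_diff Dl_gt vs us" if "\<omega> = \<theta>"
        using Op.prems q that words by (intro first_diff_total) (auto simp: Op_in_prime_words)
      then show ?thesis unfolding q prime_gt_Op_iff by fastforce
    qed
  }
qed

lemma ordered_alphabet_ALSW_primes:
  assumes "\<And>\<omega>. \<omega> \<in> \<Omega> \<Longrightarrow> ar \<omega> \<ge> 1"
  shows "ordered_alphabet succ_gt (ALSW_primes X \<Omega> ar)"
  unfolding succ_gt_eq_prime_gt
proof unfold_locales
  show "p = q \<or> prime_gt p q \<or> prime_gt q p"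
    if "p \<in> ALSW_primes X \<Omega> ar" "q \<in> ALSW_primes X \<Omega> ar" for p q
    using prime_gt_total[of \<Omega> ar p X q, OF assms] ALSW_primes_subset[of X \<Omega> ar] that by blast
qed (auto simp: prime_gt_irrefl intro: prime_gt_trans)

lemma assoc_word_map: "assoc_word (map_nword f t) = map f (assoc_word t)"
  by (induction t) auto

text \<open>
  Pairing each letter with further data is an order embedding, and standard bracketings are unique; so the
  pairs can be dropped and the letters replaced after bracketing.
\<close>

lemma (in ordered_alphabet) bracket_letters_eq:
  assumes "u \<in> ALSW gt Z"
  shows "map_nword snd (shirshov_bracketing (\<lambda>a b. gt (fst a) (fst b)) (map (\<lambda>p. (p, f p)) u)) =
    map_nword f (shirshov_bracketing gt u)"
proof -
  let ?pr = "\<lambda>p. (p, f p)" and ?gt = "\<lambda>a b. gt (fst a) (fst b)"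
  interpret pairs: ordered_alphabet ?gt "?pr ` Z"
  proof unfold_locales
    show "a = b \<or> ?gt a b \<or> ?gt b a" if "a \<in> ?pr ` Z" "b \<in> ?pr ` Z" for a b
      using that total[of "fst a" "fst b"] by fastforce
  qed (use irrefl in blast, use trans in blast)
  have lex: "lex_gt ?gt (map ?pr v) (map ?pr w) \<longleftrightarrow> v \<succ> w" for v w
    by (induction gt v w rule: lex_gt.induct) auto
  have alsw: "map ?pr w \<in> ALSW ?gt (?pr ` Z)" if "w \<in> ALSW gt Z" for w
    using that unfolding ALSW_def words_on_def
    by (auto simp: map_eq_append_conv lex simp flip: map_append)
  have "is_NLSW ?gt (?pr ` Z) (map_nword ?pr t)" if "is_NLSW gt Z t" for t
    using that
  proof (induction t)
    case (Leaf z)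
    then show ?case using alsw[of "[z]"] by simp
  next
    case (Br v w)
    have "map ?pr (assoc_word (Br v w)) \<in> ALSW ?gt (?pr ` Z)" using Br.prems by (intro alsw) simp
    then show ?case using Br by (cases v) (auto simp: assoc_word_map lex)
  qed
  from pairs.shirshov_bracketing_eq[OF this[OF shirshov_bracketing(1)[OF assms]]]
  have "shirshov_bracketing ?gt (map ?pr u) = map_nword ?pr (shirshov_bracketing gt u)"
    by (simp add: assoc_word_map shirshov_bracketing(2)[OF assms])
  then show ?thesis by (simp add: nword.map_comp comp_def)
qed

lemma bracketing_eq:
  assumes "\<And>\<omega>. \<omega> \<in> \<Omega> \<Longrightarrow> ar \<omega> \<ge> 1" "u \<in> ALSW_op X \<Omega> ar"
  shows "bracketing u = map_nword bracket_prime (shirshov_bracketing succ_gt u)"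
  unfolding bracketing_def bracket_letters_def
  by (rule ordered_alphabet.bracket_letters_eq[OF ordered_alphabet_ALSW_primes[OF assms(1)]])
    (use assms(2) ALSW_op_eq in auto)

section \<open>Values of Lyndon-Shirshov \<open>\<Omega>\<close>-words in a Lie \<open>\<Omega>\<close>-algebra\<close>

text \<open>
  The map \<open>nprime_value\<close> for an arbitrary Lie \<open>\<Omega>\<close>-algebra and arbitrary images of the generators.
\<close>

primrec nprime_eval ::
  "('v \<Rightarrow> 'v \<Rightarrow> 'v) \<Rightarrow> ('o \<Rightarrow> 'v list \<Rightarrow> 'v) \<Rightarrow> ('x \<Rightarrow> 'v) \<Rightarrow> ('x, 'o) nprime \<Rightarrow> 'v" where
  "nprime_eval br opr \<sigma> (NVar x) = \<sigma> x"
| "nprime_eval br opr \<sigma> (NOp \<omega> ts) =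
     opr \<omega> (map (lie_value br) (map (map_nword (nprime_eval br opr \<sigma>)) ts))"

locale lie_omega_evaluation = lie_omega_algebra scale \<Omega> ar L br opr
  for scale :: "'k::field \<Rightarrow> 'v::ab_group_add \<Rightarrow> 'v" and \<Omega> :: "'o::wellorder set" and ar L br opr +
  fixes X :: "'x::wellorder set" and \<sigma> :: "'x \<Rightarrow> 'v"
  assumes arity_pos: "\<And>\<omega>. \<omega> \<in> \<Omega> \<Longrightarrow> ar \<omega> \<ge> 1" and gens_in_L: "\<sigma> \<in> X \<rightarrow> L"
begin

definition prime_val :: "('x, 'o) prime_word \<Rightarrow> 'v" where
  "prime_val p = nprime_eval br opr \<sigma> (bracket_prime p)"

definition word_val :: "('x, 'o) oword \<Rightarrow> 'v" where
  "word_val u = lie_value br (map_nword (nprime_eval br opr \<sigma>) (bracketing u))"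

lemma word_val_eq:
  assumes "u \<in> ALSW_op X \<Omega> ar"
  shows "word_val u = lie_value br (map_nword prime_val (shirshov_bracketing succ_gt u))"
  using bracketing_eq[OF arity_pos assms]
  by (simp add: word_val_def prime_val_def[abs_def] nword.map_comp comp_def)

lemma prime_val_Var: "prime_val (Var x) = \<sigma> x"
  by (simp add: prime_val_def)

lemma prime_val_Op: "prime_val (Op \<omega> us) = opr \<omega> (map word_val us)"
  by (simp add: prime_val_def word_val_def[abs_def] bracketing_def comp_def)

sublocale ordered_alphabet succ_gt "ALSW_primes X \<Omega> ar"
  by (rule ordered_alphabet_ALSW_primes[OF arity_pos])

text \<open>
  For the whole algebra in place of \<open>M\<close> this says that the letters have values in \<open>L\<close>, which makes the
  results on Lyndon-Shirshov words over the alphabet of prime words available.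
\<close>

lemma prime_val_in_subalgebra:
  assumes M: "lie_omega_subalgebra scale \<Omega> ar L br opr M" and gens: "\<sigma> ` X \<subseteq> M"
  shows "p \<in> ALSW_primes X \<Omega> ar \<Longrightarrow> prime_val p \<in> M"
proof (induction p)
  case (Var x)
  then show ?case using gens by (auto simp: prime_val_Var ALSW_primes_def op_words_def)
next
  case (Op \<omega> us)
  have M_br: "\<And>x y. x \<in> M \<Longrightarrow> y \<in> M \<Longrightarrow> br x y \<in> M"
    using M by (simp add: lie_omega_subalgebra_def)
  have "word_val u \<in> M" if u: "u \<in> set us" for u
  proof -
    have "u \<in> ALSW succ_gt (ALSW_primes X \<Omega> ar)" "u \<in> ALSW_op X \<Omega> ar"
      using u Op.prems by (auto simp: Op_in_ALSW_primes ALSW_op_eq)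
    then show ?thesis using Op.IH[OF u] ALSW_words[of u]
      by (auto simp: word_val_eq shirshov_bracketing intro!: lie_value_in[OF M_br])
  qed
  then have "set (map word_val us) \<subseteq> M" by auto
  moreover have "\<omega> \<in> \<Omega>" "length (map word_val us) = ar \<omega>"
    using Op.prems by (auto simp: Op_in_ALSW_primes)
  ultimately show ?case using M unfolding prime_val_Op lie_omega_subalgebra_def by blast
qed

lemma word_val_in_subalgebra:
  assumes M: "lie_omega_subalgebra scale \<Omega> ar L br opr M" and gens: "\<sigma> ` X \<subseteq> M"
    and u: "u \<in> ALSW_op X \<Omega> ar"
  shows "word_val u \<in> M"
proof -
  have u': "u \<in> ALSW succ_gt (ALSW_primes X \<Omega> ar)" using u ALSW_op_eq by blast
  have "set u \<subseteq> ALSW_primes X \<Omega> ar" using ALSW_words[OF u'] by blast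
  then have "prime_val ` set u \<subseteq> M" using prime_val_in_subalgebra[OF M gens] by blast
  moreover have "\<And>x y. x \<in> M \<Longrightarrow> y \<in> M \<Longrightarrow> br x y \<in> M"
    using M by (simp add: lie_omega_subalgebra_def)
  ultimately show ?thesis unfolding word_val_eq[OF u]
    by (intro lie_value_in) (simp_all add: shirshov_bracketing[OF u'])
qed

lemma subalgebra_L: "lie_omega_subalgebra scale \<Omega> ar L br opr L"
  using subspace_L br_closed opr_closed by (simp add: lie_omega_subalgebra_def)

sublocale lyndon_values scale \<Omega> ar L br opr succ_gt "ALSW_primes X \<Omega> ar" prime_val
  by unfold_locales (use prime_val_in_subalgebra[OF subalgebra_L] gens_in_L in blast)

lemma word_val_eq_val: "word_val ` ALSW_op X \<Omega> ar = val ` ALSW succ_gt (ALSW_primes X \<Omega> ar)"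
  unfolding ALSW_op_eq[symmetric] by (rule image_cong) (simp_all add: word_val_eq val_def)

lemma word_val_prime:
  assumes "p \<in> ALSW_primes X \<Omega> ar"
  shows "[p] \<in> ALSW_op X \<Omega> ar" "word_val [p] = prime_val p"
proof -
  show *: "[p] \<in> ALSW_op X \<Omega> ar" using letter_in_ALSW[OF assms] by (simp add: ALSW_op_eq)
  have "shirshov_bracketing succ_gt [p] = Leaf p"
    using shirshov_bracketing_eq[of "Leaf p"] letter_in_ALSW[OF assms] by simp
  then show "word_val [p] = prime_val p" using word_val_eq[OF *] by simp
qed

text \<open>
  Closure under operators reduces to arguments that are values of Lyndon-Shirshov \<open>\<Omega>\<close>-words
  \<open>u\<^sub>1,\<dots>,u\<^sub>m\<close>, and then \<open>\<omega>\<close> yields the value of the one-letter word \<open>\<omega>(u\<^sub>1,\<dots>,u\<^sub>m)\<close>.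
\<close>

theorem span_word_val_subalgebra:
  "lie_omega_subalgebra scale \<Omega> ar L br opr (span (word_val ` ALSW_op X \<Omega> ar))"
  unfolding lie_omega_subalgebra_def
proof (intro conjI ballI allI impI)
  let ?S = "word_val ` ALSW_op X \<Omega> ar"
  have S: "?S \<subseteq> L" using word_val_in_subalgebra[OF subalgebra_L] gens_in_L by blast
  then show "span ?S \<subseteq> L" by (rule span_subset_L)
  show "br x y \<in> span ?S" if "x \<in> span ?S" "y \<in> span ?S" for x y
    using span_val_closed that unfolding word_val_eq_val by blast
  show "opr \<omega> xs \<in> span ?S" if \<omega>: "\<omega> \<in> \<Omega>" and xs: "length xs = ar \<omega> \<and> set xs \<subseteq> span ?S" for \<omega> xs
  proof (rule opr_span_closed[OF S \<omega>])
    fix ys assume ys: "length ys = ar \<omega>" "set ys \<subseteq> ?S"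
    then have "ys \<in> lists ?S" by blast
    then obtain us where us: "ys = map word_val us" "set us \<subseteq> ALSW_op X \<Omega> ar"
      unfolding lists_image by auto
    have p: "Op \<omega> us \<in> ALSW_primes X \<Omega> ar" using us ys \<omega> by (simp add: Op_in_ALSW_primes)
    have "opr \<omega> ys = word_val [Op \<omega> us]" using word_val_prime[OF p] us by (simp add: prime_val_Op)
    then show "opr \<omega> ys \<in> span ?S" using word_val_prime(1)[OF p] by (simp add: span_base)
  qed (use xs in auto)
qed simp

theorem generated_subalgebra_eq_span:
  "lie_omega_subalgebra scale \<Omega> ar L br opr hull (\<sigma> ` X) = span (word_val ` ALSW_op X \<Omega> ar)"
proof
  have "\<sigma> x \<in> word_val ` ALSW_op X \<Omega> ar" if "x \<in> X" for x
    using word_val_prime[of "Var x"] that by (auto simp: ALSW_primes_def prime_val_Var intro: rev_image_eqI)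
  then have "\<sigma> ` X \<subseteq> span (word_val ` ALSW_op X \<Omega> ar)" using span_base by blast
  then show "lie_omega_subalgebra scale \<Omega> ar L br opr hull (\<sigma> ` X) \<subseteq> span (word_val ` ALSW_op X \<Omega> ar)"
    using span_word_val_subalgebra by (rule hull_minimal)
next
  have "span (word_val ` ALSW_op X \<Omega> ar) \<subseteq> M"
    if M: "lie_omega_subalgebra scale \<Omega> ar L br opr M" "\<sigma> ` X \<subseteq> M" for M
  proof (rule span_minimal)
    show "subspace M" using M by (simp add: lie_omega_subalgebra_def)
  qed (use word_val_in_subalgebra[OF M] in blast)
  then show "span (word_val ` ALSW_op X \<Omega> ar) \<subseteq> lie_omega_subalgebra scale \<Omega> ar L br opr hull (\<sigma> ` X)"
    unfolding hull_def by blast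
qed

end

section \<open>The free associative \<open>\<Omega>\<close>-algebra as a Lie \<open>\<Omega>\<close>-algebra\<close>

abbreviation "coeff \<equiv> Poly_Mapping.lookup"

lemma coeff_scale: "coeff (opoly_scale c f) w = c * coeff f w"
  by (simp add: opoly_scale_def Poly_Mapping.map.rep_eq when_def)

lemma opoly_vector_space: "vector_space (opoly_scale :: 'k::field \<Rightarrow> ('x, 'o, 'k) opoly \<Rightarrow> _)"
  by unfold_locales
    (auto intro!: poly_mapping_eqI simp: coeff_scale lookup_add algebra_simps)

text \<open>
  The coefficients of a product are indexed by the positions at which a word can be cut. In this form
  bilinearity is immediate and associativity is a reindexing of pairs of cuts.
\<close>

lemma coeff_mult:
  "coeff (opoly_mult f g) w = (\<Sum>i\<le>length w. coeff f (take i w) * coeff g (drop i w))"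
proof -
  let ?S = "(\<lambda>i. (take i w, drop i w)) ` {..length w}"
  have inj: "inj_on (\<lambda>i. (take i w, drop i w)) {..length w}"
    by (rule inj_onI) (metis Pair_inject atMost_iff length_take min.absorb2)
  have S: "(u, v) \<in> ?S \<longleftrightarrow> u @ v = w" for u v
    by (auto intro!: image_eqI[of _ _ "length u"])
  have "coeff (opoly_mult f g) w =
    (\<Sum>(u, v)\<in>Poly_Mapping.keys f \<times> Poly_Mapping.keys g. coeff f u * coeff g v when u @ v = w)"
    by (simp add: opoly_mult_def lookup_sum lookup_single sum.cartesian_product case_prod_unfold)
  also have "\<dots> = (\<Sum>(u, v)\<in>?S. coeff f u * coeff g v)"
    by (rule sum.mono_neutral_cong) (auto simp: S when_def in_keys_iff simp flip: S)
  also have "\<dots> = (\<Sum>i\<le>length w. coeff f (take i w) * coeff g (drop i w))"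
    by (simp add: sum.reindex[OF inj])
  finally show ?thesis .
qed

lemma opoly_mult_add_left: "opoly_mult (f + g) h = opoly_mult f h + opoly_mult g h"
  by (rule poly_mapping_eqI) (simp add: coeff_mult lookup_add distrib_right sum.distrib)

lemma opoly_mult_add_right: "opoly_mult h (f + g) = opoly_mult h f + opoly_mult h g"
  by (rule poly_mapping_eqI) (simp add: coeff_mult lookup_add distrib_left sum.distrib)

lemma opoly_mult_diff_left: "opoly_mult (f - g) h = opoly_mult f h - opoly_mult g h"
  by (rule poly_mapping_eqI) (simp add: coeff_mult lookup_minus left_diff_distrib sum_subtractf)

lemma opoly_mult_diff_right: "opoly_mult h (f - g) = opoly_mult h f - opoly_mult h g"
  by (rule poly_mapping_eqI) (simp add: coeff_mult lookup_minus right_diff_distrib sum_subtractf)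

lemma opoly_mult_scale_left: "opoly_mult (opoly_scale c f) g = opoly_scale c (opoly_mult f g)"
  by (rule poly_mapping_eqI) (simp add: coeff_mult coeff_scale sum_distrib_left mult.assoc)

lemma opoly_mult_scale_right: "opoly_mult f (opoly_scale c g) = opoly_scale c (opoly_mult f g)"
  by (rule poly_mapping_eqI) (simp add: coeff_mult coeff_scale sum_distrib_left mult.left_commute)

lemma opoly_scale_diff: "opoly_scale c (f - g) = opoly_scale c f - opoly_scale c g"
  by (rule poly_mapping_eqI) (simp add: coeff_scale lookup_minus right_diff_distrib)

lemma opoly_mult_assoc: "opoly_mult (opoly_mult f g) h = opoly_mult f (opoly_mult g h)"
proof (rule poly_mapping_eqI)
  fix w
  define F where "F j i = coeff f (take j w) * coeff g (drop j (take i w)) * coeff h (drop i w)" for j i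
  have "coeff (opoly_mult (opoly_mult f g) h) w = (\<Sum>i\<le>length w. \<Sum>j\<le>i. F j i)"
    by (auto simp: coeff_mult F_def sum_distrib_right min_absorb1 min_absorb2 intro!: sum.cong)
  also have "\<dots> = (\<Sum>i\<le>length w. \<Sum>j\<le>i. F j (j + (i - j)))"
    by (intro sum.cong) auto
  also have "\<dots> = (\<Sum>(j, k)\<in>{(j, k). j + k \<le> length w}. F j (j + k))"
    by (rule sum.triangle_reindex_eq[symmetric])
  also have "{(j, k). j + k \<le> length w} = (SIGMA j:{..length w}. {..length w - j})"
    by auto
  also have "(\<Sum>(j, k)\<in>\<dots>. F j (j + k)) = (\<Sum>j\<le>length w. \<Sum>k\<le>length w - j. F j (j + k))"
    by (rule sum.Sigma[symmetric]) auto
  also have "\<dots> = coeff (opoly_mult f (opoly_mult g h)) w"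
    by (simp add: coeff_mult F_def sum_distrib_left mult.assoc take_drop add.commute)
  finally show "coeff (opoly_mult (opoly_mult f g) h) w = coeff (opoly_mult f (opoly_mult g h)) w" .
qed

lemma listset_iff: "us \<in> listset As \<longleftrightarrow> list_all2 (\<in>) us As"
proof (induction As arbitrary: us)
  case (Cons A As)
  then show ?case by (cases us) (auto simp: set_Cons_def)
qed simp

lemma finite_listset: "(\<And>A. A \<in> set As \<Longrightarrow> finite A) \<Longrightarrow> finite (listset As)"
proof (induction As)
  case (Cons A As)
  have "set_Cons A (listset As) = (\<lambda>(a, as). a # as) ` (A \<times> listset As)"
    by (auto simp: set_Cons_def)
  then show ?case using Cons by simp
qed simp

lemma prod_coeff_nonzero_iff:
  fixes fs :: "('x, 'o, 'k::field) opoly list"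
  assumes "length us = length fs"
  shows "prod_list (map2 coeff fs us) \<noteq> 0 \<longleftrightarrow> us \<in> listset (map Poly_Mapping.keys fs)"
  using assms[symmetric]
  by (induction fs us rule: list_induct2) (auto simp: in_keys_iff set_Cons_def)

lemma coeff_op:
  "coeff (opoly_op \<omega> fs) [Op \<omega> us] =
     (if length us = length fs then prod_list (map2 coeff fs us) else 0)"
proof -
  let ?S = "listset (map Poly_Mapping.keys fs)"
  have fin: "finite ?S" by (rule finite_listset) auto
  have "coeff (opoly_op \<omega> fs) [Op \<omega> us] =
      (\<Sum>vs\<in>?S. if vs = us then prod_list (map2 coeff fs vs) else 0)"
    by (simp add: opoly_op_def lookup_sum lookup_single when_def)
  also have "\<dots> = (if us \<in> ?S then prod_list (map2 coeff fs us) else 0)"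
    using fin by simp
  also have "\<dots> = (if length us = length fs then prod_list (map2 coeff fs us) else 0)"
    using prod_coeff_nonzero_iff[of us fs] by (auto simp: listset_iff dest: list_all2_lengthD)
  finally show ?thesis .
qed

lemma coeff_op_other: "(\<And>us. w \<noteq> [Op \<omega> us]) \<Longrightarrow> coeff (opoly_op \<omega> fs) w = 0"
  by (simp add: opoly_op_def lookup_sum lookup_single not_sym)

lemma keys_opoly_op:
  assumes "w \<in> Poly_Mapping.keys (opoly_op \<omega> fs)"
  obtains us where "w = [Op \<omega> us]" "list_all2 (\<lambda>u f. u \<in> Poly_Mapping.keys f) us fs"
proof -
  obtain us where us: "w = [Op \<omega> us]"
    using assms coeff_op_other[of w \<omega> fs] by (auto simp: in_keys_iff)
  then have "us \<in> listset (map Poly_Mapping.keys fs)"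
    using assms prod_coeff_nonzero_iff[of us fs] by (auto simp: in_keys_iff coeff_op split: if_splits)
  then show ?thesis using us that by (simp add: listset_iff list_all2_map2)
qed

text \<open>
  Suited to comparing values of \<open>\<omega>\<close>, whose coefficients are known at the words \<open>\<omega>(u\<^sub>1,\<dots>,u\<^sub>m)\<close> and vanish elsewhere.
\<close>

lemma opoly_op_eqI:
  assumes "\<And>us. coeff f [Op \<omega> us] = coeff g [Op \<omega> us]"
    "\<And>w. (\<And>us. w \<noteq> [Op \<omega> us]) \<Longrightarrow> coeff f w = coeff g w"
  shows "f = g"
  using assms by (metis poly_mapping_eqI)

lemma prod_coeff_update:
  assumes "i < length fs" "length us = length fs"
  shows "prod_list (map2 coeff (fs[i := f]) us) =
    coeff f (us ! i) * (\<Prod>j\<in>{..<length fs} - {i}. coeff (fs ! j) (us ! j))"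
proof -
  have "prod_list (map2 coeff (fs[i := f]) us) = (\<Prod>j<length fs. coeff (fs[i := f] ! j) (us ! j))"
    using assms by (simp add: prod.list_conv_set_nth lessThan_atLeast0)
  also have "\<dots> = coeff (fs[i := f] ! i) (us ! i) *
      (\<Prod>j\<in>{..<length fs} - {i}. coeff (fs[i := f] ! j) (us ! j))"
    using assms by (intro prod.remove) auto
  finally show ?thesis using assms by simp
qed

lemma opoly_op_add:
  assumes "i < length fs"
  shows "opoly_op \<omega> (fs[i := f + g]) = opoly_op \<omega> (fs[i := f]) + opoly_op \<omega> (fs[i := g])"
  by (rule opoly_op_eqI[of _ \<omega>])
    (use assms in \<open>auto simp: lookup_add coeff_op coeff_op_other prod_coeff_update distrib_right\<close>)

lemma opoly_op_scale:
  assumes "i < length fs"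
  shows "opoly_op \<omega> (fs[i := opoly_scale c f]) = opoly_scale c (opoly_op \<omega> (fs[i := f]))"
  by (rule opoly_op_eqI[of _ \<omega>])
    (use assms in \<open>auto simp: coeff_scale coeff_op coeff_op_other prod_coeff_update\<close>)

lemma keys_opoly_mult:
  "w \<in> Poly_Mapping.keys (opoly_mult f g) \<Longrightarrow>
    \<exists>u\<in>Poly_Mapping.keys f. \<exists>v\<in>Poly_Mapping.keys g. w = u @ v"
proof -
  assume "w \<in> Poly_Mapping.keys (opoly_mult f g)"
  then obtain i where "coeff f (take i w) * coeff g (drop i w) \<noteq> 0"
    unfolding in_keys_iff coeff_mult by (meson sum.neutral)
  then show ?thesis by (metis append_take_drop_id in_keys_iff mult_zero_left mult_zero_right)
qed

lemma keys_opoly_commutator: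
  "w \<in> Poly_Mapping.keys (opoly_commutator f g) \<Longrightarrow>
    \<exists>u\<in>Poly_Mapping.keys f. \<exists>v\<in>Poly_Mapping.keys g. w = u @ v \<or> w = v @ u"
  using keys_diff[of "opoly_mult f g" "opoly_mult g f"] keys_opoly_mult[of w f g] keys_opoly_mult[of w g f]
  unfolding opoly_commutator_def by blast

lemma opolys_lie_omega_algebra:
  "lie_omega_algebra opoly_scale \<Omega> ar (opolys X \<Omega> ar :: ('x, 'o, 'k::field) opoly set)
    opoly_commutator opoly_op"
proof -
  interpret vector_space "opoly_scale :: 'k \<Rightarrow> ('x, 'o, 'k) opoly \<Rightarrow> _"
    by (rule opoly_vector_space)
  show ?thesis
  proof
    show "subspace (opolys X \<Omega> ar :: ('x, 'o, 'k) opoly set)"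
    proof (rule subspaceI)
      fix f g :: "('x, 'o, 'k) opoly" and c
      assume f: "f \<in> opolys X \<Omega> ar"
      show "f + g \<in> opolys X \<Omega> ar" if "g \<in> opolys X \<Omega> ar"
        using f that Poly_Mapping.keys_add[of f g] by (auto simp: opolys_def)
      show "opoly_scale c f \<in> opolys X \<Omega> ar"
        using f by (auto simp: opolys_def in_keys_iff coeff_scale)
    qed (simp add: opolys_def)
    show "opoly_commutator f g \<in> opolys X \<Omega> ar" if "f \<in> opolys X \<Omega> ar" "g \<in> opolys X \<Omega> ar"
      for f g :: "('x, 'o, 'k) opoly"
      using that keys_opoly_commutator[of _ f g] by (fastforce simp: opolys_def owords_eq words_on_def)
    show "opoly_op \<omega> fs \<in> opolys X \<Omega> ar"
      if "\<omega> \<in> \<Omega>" "length fs = ar \<omega>" "set fs \<subseteq> opolys X \<Omega> ar" for \<omega> and fs :: "('x, 'o, 'k) opoly list"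
    proof -
      have "w \<in> owords X \<Omega> ar" if w: "w \<in> Poly_Mapping.keys (opoly_op \<omega> fs)" for w
      proof -
        obtain us where us: "w = [Op \<omega> us]" "list_all2 (\<lambda>u f. u \<in> Poly_Mapping.keys f) us fs"
          using w by (rule keys_opoly_op)
        then have "set us \<subseteq> owords X \<Omega> ar" "length us = ar \<omega>"
          using \<open>set fs \<subseteq> _\<close> \<open>length fs = _\<close>
          by (fastforce simp: list_all2_conv_all_nth in_set_conv_nth opolys_def)+
        then have "Op \<omega> us \<in> prime_words X \<Omega> ar" using \<open>\<omega> \<in> \<Omega>\<close> by (simp add: Op_in_prime_words)
        then show ?thesis using us owords_eq[of X \<Omega> ar] by (simp add: words_on_def)
      qed
      then show ?thesis by (auto simp: opolys_def)
    qed
    show "opoly_op \<omega> (fs[i := f + g]) = opoly_op \<omega> (fs[i := f]) + opoly_op \<omega> (fs[i := g])"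
      if "length fs = ar \<omega>" "i < ar \<omega>" for \<omega> i f g and fs :: "('x, 'o, 'k) opoly list"
      using that by (simp add: opoly_op_add)
    show "opoly_op \<omega> (fs[i := opoly_scale c f]) = opoly_scale c (opoly_op \<omega> (fs[i := f]))"
      if "length fs = ar \<omega>" "i < ar \<omega>" for \<omega> i f c and fs :: "('x, 'o, 'k) opoly list"
      using that by (simp add: opoly_op_scale)
  qed (simp_all add: opoly_commutator_def opoly_mult_add_left opoly_mult_add_right opoly_mult_diff_left opoly_mult_diff_right
    opoly_mult_scale_left opoly_mult_scale_right opoly_scale_diff opoly_mult_assoc)
qed

section \<open>Leading words and linear independence\<close>

text \<open>
  All words of the polynomial are required to have the degree and length of the leading word. The order
  \<open>Dl_gt\<close> then reduces to the lexicographic order of words, which is compatible with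
  concatenation and is the order in which Lyndon-Shirshov words are defined.
\<close>

definition leading_word :: "('x::wellorder, 'o::wellorder) oword \<Rightarrow> ('x, 'o, 'k::field) opoly \<Rightarrow> bool"
  where "leading_word u f \<longleftrightarrow> coeff f u = 1 \<and>
    (\<forall>v\<in>Poly_Mapping.keys f. deg v = deg u \<and> length v = length u \<and> (v = u \<or> lex_gt succ_gt u v))"

text \<open>
  Irreflexivity and transitivity hold for all terms of the type of prime words; with the empty alphabet,
  totality is void and the facts on \<open>lex_gt\<close> that do not depend on it apply to arbitrary words.
\<close>

interpretation prime_order: ordered_alphabet succ_gt "{}"
  by unfold_locales (auto simp: succ_gt_eq_prime_gt prime_gt_irrefl intro: prime_gt_trans)

lemma Dl_gt_if_lex_gt:
  "deg u = deg v \<Longrightarrow> length u = length v \<Longrightarrow> lex_gt succ_gt u v \<Longrightarrow> Dl_gt u v"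
  by (simp add: Dl_gt_iff lex_gt_iff_first_diff succ_gt_eq_prime_gt)

lemma leading_word_in_keys: "leading_word u f \<Longrightarrow> u \<in> Poly_Mapping.keys f"
  by (simp add: leading_word_def in_keys_iff)

lemma leading_word_length:
  "leading_word u f \<Longrightarrow> v \<in> Poly_Mapping.keys f \<Longrightarrow> length v = length u"
  unfolding leading_word_def by (drule conjunct2) (drule (1) bspec, elim conjE)

lemma leading_word_keys:
  "leading_word u f \<Longrightarrow> v \<in> Poly_Mapping.keys f \<Longrightarrow> v = u \<or> Dl_gt u v"
  using Dl_gt_if_lex_gt[of u v] by (auto simp: leading_word_def)

lemma deg_append: "deg (u @ v) = deg u + deg v"
  by (simp add: deg_def)

lemma leading_word_mult_keys:
  assumes "leading_word u f" "leading_word v g" "w \<in> Poly_Mapping.keys (opoly_mult f g)"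
  shows "deg w = deg (u @ v) \<and> length w = length (u @ v) \<and> (w = u @ v \<or> lex_gt succ_gt (u @ v) w)"
proof -
  obtain a b where ab: "a \<in> Poly_Mapping.keys f" "b \<in> Poly_Mapping.keys g" "w = a @ b"
    using keys_opoly_mult assms(3) by blast
  have "deg a = deg u" "length a = length u" "a = u \<or> lex_gt succ_gt u a"
    "deg b = deg v" "length b = length v" "b = v \<or> lex_gt succ_gt v b"
    using assms ab by (auto simp: leading_word_def)
  then show ?thesis
    using ab(3) prime_order.lex_gt_extend[of u a v b] by (auto simp: deg_append prime_order.lex_gt_cancel)
qed

text \<open>
  All words of \<open>f\<close> have the length of \<open>u\<close>, so the only cut of \<open>uv\<close> that contributes to the
  coefficient in \<open>fg\<close> is the one after \<open>u\<close>; in \<open>gf\<close> every word is at most \<open>vu\<close> and hence less than \<open>uv\<close>.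
\<close>

lemma leading_word_commutator:
  assumes f: "leading_word u f" and g: "leading_word v g" and uv: "lex_gt succ_gt (u @ v) (v @ u)"
  shows "leading_word (u @ v) (opoly_commutator f g)"
proof -
  have below: "lex_gt succ_gt (u @ v) w" if "w \<in> Poly_Mapping.keys (opoly_mult g f)" for w
    using leading_word_mult_keys[OF g f that] uv prime_order.lex_gt_trans by blast
  have other: "coeff f (take i (u @ v)) = 0" if "i \<le> length (u @ v)" "i \<noteq> length u" for i
  proof (rule ccontr)
    assume "coeff f (take i (u @ v)) \<noteq> 0"
    then have "take i (u @ v) \<in> Poly_Mapping.keys f" by (simp add: in_keys_iff)
    then have "length (take i (u @ v)) = length u" by (rule leading_word_length[OF f])
    then show False using that by simp
  qed
  have "coeff f (take i (u @ v)) * coeff g (drop i (u @ v)) =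
      (if i = length u then coeff f u * coeff g v else 0)" if "i \<le> length (u @ v)" for i
    using other[OF that] by (cases "i = length u") simp_all
  then have "coeff (opoly_mult f g) (u @ v) = coeff f u * coeff g v"
    unfolding coeff_mult by simp
  then have "coeff (opoly_mult f g) (u @ v) = 1" using f g by (simp add: leading_word_def)
  moreover have "coeff (opoly_mult g f) (u @ v) = 0"
    using below[of "u @ v"] prime_order.lex_gt_irrefl[of "u @ v"] by (auto simp: in_keys_iff)
  moreover have "deg w = deg (u @ v) \<and> length w = length (u @ v) \<and> (w = u @ v \<or> lex_gt succ_gt (u @ v) w)"
    if "w \<in> Poly_Mapping.keys (opoly_commutator f g)" for w
  proof -
    have "w \<in> Poly_Mapping.keys (opoly_mult f g) \<or> w \<in> Poly_Mapping.keys (opoly_mult g f)"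
      using that keys_diff[of "opoly_mult f g" "opoly_mult g f"] unfolding opoly_commutator_def by blast
    then show ?thesis
      using leading_word_mult_keys[OF f g] leading_word_mult_keys[OF g f, of w] below
      by (auto simp: deg_append)
  qed
  ultimately show ?thesis
    unfolding leading_word_def by (simp add: opoly_commutator_def lookup_minus)
qed

lemma prime_deg_Op: "prime_deg (Op \<omega> us) = 1 + sum_list (map deg us)"
  by (simp add: deg_def[abs_def])

text \<open>
  Replacing arguments by smaller ones of the same degree keeps the degree of \<open>\<omega>(u\<^sub>1,\<dots>,u\<^sub>m)\<close>, and the first
  replaced argument decides the comparison.
\<close>

lemma leading_word_op:
  assumes "list_all2 leading_word us fs"
  shows "leading_word [Op \<omega> us] (opoly_op \<omega> fs)"
proof -
  have "prod_list (map2 coeff fs us) = 1"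
    using assms by (induction us fs rule: list_all2_induct) (auto simp: leading_word_def)
  then have "coeff (opoly_op \<omega> fs) [Op \<omega> us] = 1"
    using assms by (simp add: coeff_op list_all2_lengthD)
  moreover have "deg w = deg [Op \<omega> us] \<and> length w = length [Op \<omega> us] \<and>
      (w = [Op \<omega> us] \<or> lex_gt succ_gt [Op \<omega> us] w)"
    if key: "w \<in> Poly_Mapping.keys (opoly_op \<omega> fs)" for w
  proof -
    obtain vs where w: "w = [Op \<omega> vs]" and vs: "list_all2 (\<lambda>v f. v \<in> Poly_Mapping.keys f) vs fs"
      by (rule keys_opoly_op[OF key])
    have len: "length us = length vs" using assms vs by (simp add: list_all2_conv_all_nth)
    have nth: "leading_word (us ! i) (fs ! i) \<and> vs ! i \<in> Poly_Mapping.keys (fs ! i)"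
      if "i < length us" for i
      using assms vs that by (simp add: list_all2_conv_all_nth)
    have "map deg vs = map deg us"
      using nth len by (intro nth_equalityI) (auto simp: leading_word_def)
    moreover have "vs = us \<or> first_diff Dl_gt us vs"
      using nth len leading_word_keys
      by (intro first_diff_pointwise) (auto simp: list_all2_conv_all_nth)
    ultimately have "prime_deg (Op \<omega> vs) = prime_deg (Op \<omega> us)"
      "vs = us \<or> prime_gt (Op \<omega> us) (Op \<omega> vs)"
      by (simp_all add: prime_gt_Op_iff prime_deg_Op del: prime_deg.simps)
    then show ?thesis by (auto simp: w deg_def succ_gt_eq_prime_gt simp del: prime_deg.simps)
  qed
  ultimately show ?thesis by (simp add: leading_word_def)
qed

text \<open>
  In a vanishing combination take a maximal \<open>m\<close> among the leading words with nonzero coefficient: no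
  other summand contains \<open>m\<close>.
\<close>

lemma leading_words_independent:
  fixes f :: "('x::wellorder, 'o::wellorder) oword \<Rightarrow> ('x, 'o, 'k::field) opoly"
  assumes lead: "\<And>u. u \<in> S \<Longrightarrow> leading_word u (f u)"
  shows "inj_on f S" "\<not> module.dependent opoly_scale (f ` S)"
proof -
  show inj: "inj_on f S"
  proof (rule inj_onI)
    fix u v assume uv: "u \<in> S" "v \<in> S" "f u = f v"
    then have "u \<in> Poly_Mapping.keys (f v)" "v \<in> Poly_Mapping.keys (f u)"
      using leading_word_in_keys[OF lead[OF uv(1)]] leading_word_in_keys[OF lead[OF uv(2)]] by simp_all
    then have "u = v \<or> Dl_gt v u" "v = u \<or> Dl_gt u v"
      using lead uv leading_word_keys by blast+
    then show "u = v" using Dl_gt_trans Dl_gt_irrefl by blast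
  qed
  interpret vector_space "opoly_scale :: 'k \<Rightarrow> ('x, 'o, 'k) opoly \<Rightarrow> _"
    by (rule opoly_vector_space)
  show "independent (f ` S)"
    unfolding independent_explicit_module
  proof (intro allI impI)
    fix t and c :: "_ \<Rightarrow> 'k" and v
    assume t: "finite t" "t \<subseteq> f ` S" and zero: "(\<Sum>v\<in>t. opoly_scale (c v) v) = 0" and v: "v \<in> t"
    show "c v = 0"
    proof (rule ccontr)
      assume "c v \<noteq> 0"
      let ?T = "{u \<in> S. f u \<in> t \<and> c (f u) \<noteq> 0}"
      have "finite ?T"
        by (rule inj_on_finite[of f _ t]) (use inj t in \<open>auto intro: inj_on_subset\<close>)
      moreover have "?T \<noteq> {}" using v t \<open>c v \<noteq> 0\<close> by blast
      moreover have "asymp_on ?T (\<lambda>a b. Dl_gt b a)"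
        by (rule asymp_onI) (metis Dl_gt_trans Dl_gt_irrefl)
      moreover have "transp_on ?T (\<lambda>a b. Dl_gt b a)"
        by (rule transp_onI) (rule Dl_gt_trans)
      ultimately obtain m where m: "m \<in> ?T" and max: "\<forall>u\<in>?T. u \<noteq> m \<longrightarrow> \<not> Dl_gt u m"
        using Finite_Set.bex_max_element[of ?T "\<lambda>a b. Dl_gt b a"] by blast
      have "coeff (opoly_scale (c w) w) m = (if w = f m then c (f m) else 0)" if w: "w \<in> t" for w
      proof (cases "w = f m")
        case True
        then show ?thesis using lead m by (simp add: coeff_scale leading_word_def)
      next
        case False
        obtain u where u: "u \<in> S" "w = f u" using w t by blast
        have "c w = 0 \<or> coeff w m = 0"
        proof (rule ccontr)
          assume "\<not> ?thesis"
          then have "u \<in> ?T" "m \<in> Poly_Mapping.keys (f u)" "u \<noteq> m"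
            using u w False by (auto simp: in_keys_iff)
          then show False using max leading_word_keys[OF lead[OF u(1)], of m] by blast
        qed
        then show ?thesis using False by (auto simp: coeff_scale)
      qed
      then have "coeff (\<Sum>w\<in>t. opoly_scale (c w) w) m = c (f m)"
        using t m by (simp add: lookup_sum)
      then show False using zero m by simp
    qed
  qed
qed

section \<open>Lyndon-Shirshov \<open>\<Omega>\<close>-words as a basis of \<open>Lie(\<Omega>;X)\<close>\<close>

lemma commutator_value_eq: "commutator_value = lie_value opoly_commutator"
proof
  show "commutator_value t = lie_value opoly_commutator t" for t :: "('x, 'o, 'k::field) opoly nword"
    by (induction t) auto
qed

lemma nprime_value_eq:
  "(nprime_value :: ('x, 'o) nprime \<Rightarrow> ('x, 'o, 'k::field) opoly) =
    nprime_eval opoly_commutator opoly_op opoly_gen"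
proof
  fix p :: "('x, 'o) nprime"
  show "(nprime_value p :: ('x, 'o, 'k) opoly) = nprime_eval opoly_commutator opoly_op opoly_gen p"
  proof (induction p)
    case (NOp \<omega> ts)
    then have "map (map_nword (nprime_value :: _ \<Rightarrow> ('x, 'o, 'k) opoly)) ts =
      map (map_nword (nprime_eval opoly_commutator opoly_op opoly_gen)) ts"
      by (intro map_cong nword.map_cong) auto
    then show ?case by (simp only: nprime_value.simps nprime_eval.simps commutator_value_eq)
  qed simp
qed

lemma opoly_evaluation:
  assumes "\<And>\<omega>. \<omega> \<in> \<Omega> \<Longrightarrow> ar \<omega> \<ge> 1"
  shows "lie_omega_evaluation opoly_scale \<Omega> ar (opolys X \<Omega> ar :: ('x::wellorder, 'o::wellorder, 'k::field) opoly set)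
    opoly_commutator opoly_op X opoly_gen"
proof (intro lie_omega_evaluation.intro opolys_lie_omega_algebra lie_omega_evaluation_axioms.intro assms)
  have "[Var x] \<in> owords X \<Omega> ar" if "x \<in> X" for x
    using that by (subst owords_eq) (simp add: words_on_def prime_words_def)
  then show "opoly_gen \<in> X \<rightarrow> (opolys X \<Omega> ar :: ('x, 'o, 'k) opoly set)"
    by (auto simp: opolys_def opoly_gen_def)
qed

text \<open>
  The letters may have arbitrary values with the right leading words. For the alphabet of prime words
  they may be values of operators, which are sums of many words.
\<close>

lemma leading_word_lie_value:
  assumes "is_NLSW succ_gt Z t" "\<And>p. p \<in> set (assoc_word t) \<Longrightarrow> leading_word [p] (e p)"
  shows "leading_word (assoc_word t) (lie_value opoly_commutator (map_nword e t))"
  using assms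
proof (induction t)
  case (Br s t)
  have "assoc_word (Br s t) \<in> ALSW succ_gt Z" using Br.prems by simp
  then have "lex_gt succ_gt (assoc_word s @ assoc_word t) (assoc_word t @ assoc_word s)"
    using assoc_word_nonempty[of s] assoc_word_nonempty[of t] by (simp add: ALSW_def)
  then show ?case using Br by (simp add: leading_word_commutator)
qed simp

text \<open>
  The parameter \<open>field_type\<close> fixes the ground field, which does not occur in the types of the other parameters.
\<close>

locale free_lie_omega =
  fixes X :: "'x::wellorder set" and \<Omega> :: "'o::wellorder set" and ar :: "'o \<Rightarrow> nat"
    and field_type :: "'k::field itself"
  assumes arity: "\<And>\<omega>. \<omega> \<in> \<Omega> \<Longrightarrow> ar \<omega> \<ge> 1"
begin

sublocale lie_omega_evaluation opoly_scale \<Omega> ar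
  "opolys X \<Omega> ar :: ('x, 'o, 'k) opoly set" opoly_commutator opoly_op X opoly_gen
  by (rule opoly_evaluation[OF arity])

abbreviation Lie :: "('x, 'o, 'k) opoly set" where "Lie \<equiv> Lie_op X \<Omega> ar"

lemma leading_word_prime_val: "p \<in> ALSW_primes X \<Omega> ar \<Longrightarrow> leading_word [p] (prime_val p)"
proof (induction p)
  case (Var x)
  then show ?case
    unfolding prime_val_Var by (simp add: opoly_gen_def leading_word_def)
next
  case (Op \<omega> us)
  have "leading_word u (word_val u)" if u: "u \<in> set us" for u
  proof -
    have u': "u \<in> ALSW succ_gt (ALSW_primes X \<Omega> ar)" "u \<in> ALSW_op X \<Omega> ar"
      using u Op.prems by (auto simp: Op_in_ALSW_primes ALSW_op_eq)
    have "set u \<subseteq> ALSW_primes X \<Omega> ar" using ALSW_words[OF u'(1)] by blast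
    then show ?thesis
      using leading_word_lie_value[OF shirshov_bracketing(1)[OF u'(1)], of prime_val] Op.IH[OF u]
      by (auto simp: word_val_eq[OF u'(2)] shirshov_bracketing(2)[OF u'(1)])
  qed
  then show ?case
    unfolding prime_val_Op by (intro leading_word_op) (simp add: list_all2_conv_all_nth)
qed

lemma leading_word_word_val:
  assumes u: "u \<in> ALSW_op X \<Omega> ar"
  shows "leading_word u (word_val u)"
proof -
  have u': "u \<in> ALSW succ_gt (ALSW_primes X \<Omega> ar)" using u ALSW_op_eq by blast
  then show ?thesis
    using leading_word_lie_value[OF shirshov_bracketing(1)[OF u'], of prime_val] ALSW_words[OF u']
      leading_word_prime_val
    by (auto simp: word_val_eq[OF u] shirshov_bracketing(2)[OF u'])
qed

lemma word_val_eq_nword_value: "word_val u = nword_value (bracketing u)"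
  by (simp add: word_val_def nword_value_def commutator_value_eq nprime_value_eq)

lemma Lie_eq_span: "Lie = span (word_val ` ALSW_op X \<Omega> ar)"
  unfolding Lie_op_def by (rule generated_subalgebra_eq_span)

lemma word_val_basis:
  "inj_on word_val (ALSW_op X \<Omega> ar)" "independent (word_val ` ALSW_op X \<Omega> ar)"
  using leading_words_independent[OF leading_word_word_val] by blast+

lemma Lie_subalgebra:
  "lie_omega_subalgebra opoly_scale \<Omega> ar (opolys X \<Omega> ar) opoly_commutator opoly_op Lie"
  unfolding Lie_eq_span by (rule span_word_val_subalgebra)

end

section \<open>The universal property\<close>

definition prod_scale ::
  "('k \<Rightarrow> 'v \<Rightarrow> 'v) \<Rightarrow> ('k \<Rightarrow> 'a \<Rightarrow> 'a) \<Rightarrow> 'k \<Rightarrow> 'v \<times> 'a \<Rightarrow> 'v \<times> 'a" where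
  "prod_scale s s' c p = (s c (fst p), s' c (snd p))"

definition prod_br ::
  "('v \<Rightarrow> 'v \<Rightarrow> 'v) \<Rightarrow> ('a \<Rightarrow> 'a \<Rightarrow> 'a) \<Rightarrow> 'v \<times> 'a \<Rightarrow> 'v \<times> 'a \<Rightarrow> 'v \<times> 'a" where
  "prod_br b b' p q = (b (fst p) (fst q), b' (snd p) (snd q))"

definition prod_opr ::
  "('o \<Rightarrow> 'v list \<Rightarrow> 'v) \<Rightarrow> ('o \<Rightarrow> 'a list \<Rightarrow> 'a) \<Rightarrow> 'o \<Rightarrow> ('v \<times> 'a) list \<Rightarrow> 'v \<times> 'a" where
  "prod_opr f f' \<omega> ps = (f \<omega> (map fst ps), f' \<omega> (map snd ps))"

lemma product_lie_omega_algebra: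
  assumes "lie_omega_algebra scale \<Omega> ar L br opr" "lie_omega_algebra scale' \<Omega> ar L' br' opr'"
  shows "lie_omega_algebra (prod_scale scale scale') \<Omega> ar (L \<times> L') (prod_br br br') (prod_opr opr opr')"
proof -
  interpret A: lie_omega_algebra scale \<Omega> ar L br opr by fact
  interpret B: lie_omega_algebra scale' \<Omega> ar L' br' opr' by fact
  interpret V: vector_space "prod_scale scale scale'"
    by unfold_locales (simp_all add: prod_scale_def prod_eq_iff A.scale_right_distrib
      B.scale_right_distrib A.scale_left_distrib B.scale_left_distrib)
  have comp: "set (map fst xs) \<subseteq> L" "set (map snd xs) \<subseteq> L'" if "set xs \<subseteq> L \<times> L'" for xs
    using that by auto
  show ?thesis
  proof
    show "V.subspace (L \<times> L')"
      by (rule V.subspaceI) (auto simp: prod_scale_def zero_prod_def A.L_zero B.L_zero A.L_add B.L_add A.L_scale B.L_scale)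
    show "prod_opr opr opr' \<omega> xs \<in> L \<times> L'"
      if "\<omega> \<in> \<Omega>" "length xs = ar \<omega>" "set xs \<subseteq> L \<times> L'" for \<omega> xs
      using that comp[OF that(3)] by (simp add: prod_opr_def A.opr_closed B.opr_closed)
    show "prod_opr opr opr' \<omega> (xs[i := x + y]) =
        prod_opr opr opr' \<omega> (xs[i := x]) + prod_opr opr opr' \<omega> (xs[i := y])"
      if "\<omega> \<in> \<Omega>" "length xs = ar \<omega>" "set xs \<subseteq> L \<times> L'" "i < ar \<omega>" "x \<in> L \<times> L'" "y \<in> L \<times> L'"
      for \<omega> xs i x y
      using that comp[OF that(3)] by (auto simp: prod_opr_def map_update A.opr_add B.opr_add)
    show "prod_opr opr opr' \<omega> (xs[i := prod_scale scale scale' c x]) =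
        prod_scale scale scale' c (prod_opr opr opr' \<omega> (xs[i := x]))"
      if "\<omega> \<in> \<Omega>" "length xs = ar \<omega>" "set xs \<subseteq> L \<times> L'" "i < ar \<omega>" "x \<in> L \<times> L'"
      for \<omega> xs i x c
      using that comp[OF that(3)]
      by (auto simp: prod_opr_def prod_scale_def map_update A.opr_scale B.opr_scale)
  qed (auto simp: prod_br_def prod_scale_def prod_eq_iff A.br_closed B.br_closed A.br_add_left B.br_add_left
      A.br_add_right B.br_add_right A.br_scale_left B.br_scale_left A.br_scale_right B.br_scale_right
      A.br_self B.br_self A.jacobi B.jacobi)
qed

lemma fst_lie_value: "fst (lie_value (prod_br br br') t) = lie_value br (map_nword fst t)"
  by (induction t) (auto simp: prod_br_def)

lemma fst_prod_opr: "fst (prod_opr opr opr' \<omega> ps) = opr \<omega> (map fst ps)"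
  by (simp add: prod_opr_def)

lemma fst_nprime_eval:
  "fst (nprime_eval (prod_br br br') (prod_opr opr opr') \<rho> p) = nprime_eval br opr (fst \<circ> \<rho>) p"
proof (induction p)
  case (NOp \<omega> ts)
  have "map_nword (\<lambda>p. fst (nprime_eval (prod_br br br') (prod_opr opr opr') \<rho> p)) t =
      map_nword (nprime_eval br opr (fst \<circ> \<rho>)) t" if "t \<in> set ts" for t
    using NOp[OF that] by (intro nword.map_cong refl)
  then show ?case
    by (simp add: fst_prod_opr fst_lie_value nword.map_comp comp_def cong: map_cong)
qed simp

context free_lie_omega
begin

text \<open>
  The homomorphism is read off from its graph, the subalgebra of the product generated by the pairs
  \<open>(x, \<sigma> x)\<close>. That this subalgebra is the graph of a function is where linear independence
  in the first component and spanning in the product meet.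
\<close>

lemma lift_to_lie_omega_algebra:
  fixes scale' :: "'k \<Rightarrow> 'a::ab_group_add \<Rightarrow> 'a"
  assumes A: "lie_omega_algebra scale' \<Omega> ar A br' opr'" and \<sigma>: "\<sigma> \<in> X \<rightarrow> A"
  obtains \<tau> where "\<tau> \<in> extensional Lie"
    "lie_omega_hom \<Omega> ar opoly_scale Lie opoly_commutator opoly_op scale' A br' opr' \<tau>"
    "\<And>x. x \<in> X \<Longrightarrow> \<tau> (opoly_gen x) = \<sigma> x"
proof -
  let ?s = "prod_scale (opoly_scale :: 'k \<Rightarrow> ('x, 'o, 'k) opoly \<Rightarrow> _) scale'" and ?b = "prod_br opoly_commutator br'"
    and ?o = "prod_opr opoly_op opr'" and ?\<rho> = "\<lambda>x. (opoly_gen x, \<sigma> x)"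
  interpret A: lie_omega_algebra scale' \<Omega> ar A br' opr' by (rule A)
  interpret P: lie_omega_evaluation ?s \<Omega> ar "opolys X \<Omega> ar \<times> A" ?b ?o X ?\<rho>
    by (intro lie_omega_evaluation.intro product_lie_omega_algebra lie_omega_evaluation_axioms.intro
        lie_omega_algebra_axioms A arity) (use gens_in_L \<sigma> in auto)
  let ?G = "P.span (P.word_val ` ALSW_op X \<Omega> ar)"
  have fst_val: "fst (P.word_val u) = word_val u" for u
    by (simp add: P.word_val_def word_val_def fst_lie_value fst_nprime_eval nword.map_comp comp_def)
  have "Vector_Spaces.linear ?s opoly_scale fst"
    unfolding Vector_Spaces.linear_iff
    using P.vector_space_axioms vector_space_axioms by (simp add: prod_scale_def)
  then interpret proj: Vector_Spaces.linear ?s opoly_scale fst .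
  have image: "fst ` P.word_val ` ALSW_op X \<Omega> ar = word_val ` ALSW_op X \<Omega> ar"
    by (simp add: image_image fst_val)
  have inj_on_vals: "inj_on fst (P.word_val ` ALSW_op X \<Omega> ar)"
    using word_val_basis(1) by (intro inj_on_imageI) (simp add: comp_def fst_val)
  have "independent (fst ` P.word_val ` ALSW_op X \<Omega> ar)"
    unfolding image by (rule word_val_basis(2))
  then have inj: "inj_on fst ?G"
    using inj_on_vals by (rule proj.inj_on_span_independent_image)
  have surj: "fst ` ?G = Lie"
    unfolding Lie_eq_span image[symmetric] by (rule proj.span_image[symmetric])
  have G: "P.subspace ?G" "?G \<subseteq> opolys X \<Omega> ar \<times> A"
    "\<And>x y. x \<in> ?G \<Longrightarrow> y \<in> ?G \<Longrightarrow> ?b x y \<in> ?G"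
    "\<And>\<omega> xs. \<omega> \<in> \<Omega> \<Longrightarrow> length xs = ar \<omega> \<Longrightarrow> set xs \<subseteq> ?G \<Longrightarrow> ?o \<omega> xs \<in> ?G"
    using P.span_word_val_subalgebra unfolding lie_omega_subalgebra_def by blast+
  define \<tau> where "\<tau> = restrict (\<lambda>f. snd (inv_into ?G fst f)) Lie"
  have \<tau>_eq: "\<tau> f = a" if "(f, a) \<in> ?G" for f a
  proof -
    have "inv_into ?G fst f = (f, a)" using inv_into_f_f[OF inj that] by simp
    moreover have "f \<in> Lie" using that surj by force
    ultimately show ?thesis by (simp add: \<tau>_def)
  qed
  have graph: "(f, \<tau> f) \<in> ?G" if "f \<in> Lie" for f
  proof -
    from that surj obtain g where g: "g \<in> ?G" "f = fst g" by blast
    then show ?thesis using \<tau>_eq[of "fst g" "snd g"] by simp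
  qed
  have "lie_omega_hom \<Omega> ar opoly_scale Lie opoly_commutator opoly_op scale' A br' opr' \<tau>"
    unfolding lie_omega_hom_def
  proof (intro conjI ballI allI impI)
    show "\<tau> \<in> Lie \<rightarrow> A" using graph G(2) by blast
    fix f g assume f: "f \<in> Lie" and g: "g \<in> Lie"
    show "\<tau> (f + g) = \<tau> f + \<tau> g"
      using P.subspace_add[OF G(1) graph[OF f] graph[OF g]] by (intro \<tau>_eq) simp
    show "\<tau> (opoly_commutator f g) = br' (\<tau> f) (\<tau> g)"
      using G(3)[OF graph[OF f] graph[OF g]] by (intro \<tau>_eq) (simp add: prod_br_def)
  next
    fix c f assume "f \<in> Lie"
    then show "\<tau> (opoly_scale c f) = scale' c (\<tau> f)"
      using P.subspace_scale[OF G(1) graph, of f c] by (intro \<tau>_eq) (simp add: prod_scale_def)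
  next
    fix \<omega> xs assume \<omega>: "\<omega> \<in> \<Omega>" and xs: "length xs = ar \<omega> \<and> set xs \<subseteq> Lie"
    have "set (map (\<lambda>f. (f, \<tau> f)) xs) \<subseteq> ?G" using xs graph by auto
    then have "?o \<omega> (map (\<lambda>f. (f, \<tau> f)) xs) \<in> ?G" using G(4)[OF \<omega>] xs by simp
    then show "\<tau> (opoly_op \<omega> xs) = opr' \<omega> (map \<tau> xs)"
      by (intro \<tau>_eq) (simp add: prod_opr_def comp_def)
  qed
  moreover have "\<tau> (opoly_gen x) = \<sigma> x" if "x \<in> X" for x
  proof (rule \<tau>_eq)
    have "?\<rho> x \<in> lie_omega_subalgebra ?s \<Omega> ar (opolys X \<Omega> ar \<times> A) ?b ?o hull (?\<rho> ` X)"
      using that by (intro hull_inc) blast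
    then show "?\<rho> x \<in> ?G" unfolding P.generated_subalgebra_eq_span .
  qed
  ultimately show ?thesis by (intro that[of \<tau>]) (simp_all add: \<tau>_def)
qed

lemma gens_in_Lie: "opoly_gen \<in> X \<rightarrow> Lie"
  unfolding Lie_op_def by (auto intro: hull_inc)

text \<open>
  The elements on which the two homomorphisms agree form a subalgebra that contains the generators.
\<close>

lemma hom_from_Lie_unique:
  fixes scale' :: "'k \<Rightarrow> 'a::ab_group_add \<Rightarrow> 'a"
  assumes hom: "lie_omega_hom \<Omega> ar opoly_scale Lie opoly_commutator opoly_op scale' A br' opr' \<tau>"
    and hom': "lie_omega_hom \<Omega> ar opoly_scale Lie opoly_commutator opoly_op scale' A br' opr' \<tau>'"
    and gens: "\<And>x. x \<in> X \<Longrightarrow> \<tau> (opoly_gen x) = \<tau>' (opoly_gen x)"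
    and f: "f \<in> Lie"
  shows "\<tau> f = \<tau>' f"
proof -
  let ?M = "{f \<in> Lie. \<tau> f = \<tau>' f}"
  have Lie: "Lie \<subseteq> opolys X \<Omega> ar" "subspace Lie"
    "\<And>f g. f \<in> Lie \<Longrightarrow> g \<in> Lie \<Longrightarrow> opoly_commutator f g \<in> Lie"
    "\<And>\<omega> fs. \<omega> \<in> \<Omega> \<Longrightarrow> length fs = ar \<omega> \<Longrightarrow> set fs \<subseteq> Lie \<Longrightarrow> opoly_op \<omega> fs \<in> Lie"
    using Lie_subalgebra unfolding lie_omega_subalgebra_def by blast+
  have zero: "\<rho> 0 = 0"
    if "lie_omega_hom \<Omega> ar opoly_scale Lie opoly_commutator opoly_op scale' A br' opr' \<rho>" for \<rho>
  proof -
    have "\<rho> (0 + 0) = \<rho> 0 + \<rho> 0"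
      using that subspace_0[OF Lie(2)] unfolding lie_omega_hom_def by blast
    then show ?thesis by simp
  qed
  have "lie_omega_subalgebra opoly_scale \<Omega> ar (opolys X \<Omega> ar) opoly_commutator opoly_op ?M"
    unfolding lie_omega_subalgebra_def
  proof (intro conjI ballI allI impI)
    show "?M \<subseteq> opolys X \<Omega> ar" using Lie(1) by blast
    show "subspace ?M"
    proof (rule subspaceI)
      show "0 \<in> ?M" using subspace_0[OF Lie(2)] zero[OF hom] zero[OF hom'] by simp
      show "g + h \<in> ?M" if "g \<in> ?M" "h \<in> ?M" for g h
        using that subspace_add[OF Lie(2)] hom hom' by (simp add: lie_omega_hom_def)
      show "opoly_scale c g \<in> ?M" if "g \<in> ?M" for c g
        using that subspace_scale[OF Lie(2)] hom hom' by (simp add: lie_omega_hom_def)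
    qed
    show "opoly_commutator g h \<in> ?M" if "g \<in> ?M" "h \<in> ?M" for g h
      using that Lie(3) hom hom' by (simp add: lie_omega_hom_def)
    show "opoly_op \<omega> fs \<in> ?M" if \<omega>: "\<omega> \<in> \<Omega>" and fs: "length fs = ar \<omega> \<and> set fs \<subseteq> ?M" for \<omega> fs
    proof -
      have "set fs \<subseteq> Lie" using fs by blast
      moreover have "map \<tau> fs = map \<tau>' fs" using fs by (intro map_cong) auto
      moreover have "\<tau> (opoly_op \<omega> fs) = opr' \<omega> (map \<tau> fs)" "\<tau>' (opoly_op \<omega> fs) = opr' \<omega> (map \<tau>' fs)"
        using hom hom' \<omega> fs \<open>set fs \<subseteq> Lie\<close> unfolding lie_omega_hom_def by blast+
      ultimately show ?thesis using Lie(4)[OF \<omega>] fs by (metis (mono_tags, lifting) mem_Collect_eq)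
    qed
  qed
  moreover have "opoly_gen ` X \<subseteq> ?M" using gens gens_in_Lie by auto
  ultimately have "Lie \<subseteq> ?M" unfolding Lie_op_def by (intro hull_minimal)
  then show ?thesis using f by blast
qed

lemma Lie_free:
  "free_lie_omega_algebra TYPE('a::ab_group_add) \<Omega> ar X opoly_scale Lie opoly_commutator opoly_op opoly_gen"
  unfolding free_lie_omega_algebra_def
proof (intro conjI allI impI)
  show "lie_omega_algebra opoly_scale \<Omega> ar Lie opoly_commutator opoly_op"
    by (rule subalgebra_lie_omega_algebra[OF Lie_subalgebra])
  show "opoly_gen \<in> X \<rightarrow> Lie" by (rule gens_in_Lie)
  show "inj_on (opoly_gen :: 'x \<Rightarrow> ('x, 'o, 'k) opoly) X"
  proof (rule inj_onI)
    fix x y assume "(opoly_gen x :: ('x, 'o, 'k) opoly) = opoly_gen y"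
    then have "Poly_Mapping.keys (opoly_gen x :: ('x, 'o, 'k) opoly) = Poly_Mapping.keys (opoly_gen y :: ('x, 'o, 'k) opoly)"
      by (rule arg_cong)
    then show "x = y" by (simp add: opoly_gen_def)
  qed
next
  fix scale' :: "'k \<Rightarrow> 'a \<Rightarrow> 'a" and A br' opr' \<sigma>
  assume "lie_omega_algebra scale' \<Omega> ar A br' opr' \<and> \<sigma> \<in> X \<rightarrow> A"
  then obtain \<tau> where \<tau>: "\<tau> \<in> extensional Lie"
    "lie_omega_hom \<Omega> ar opoly_scale Lie opoly_commutator opoly_op scale' A br' opr' \<tau>"
    "\<And>x. x \<in> X \<Longrightarrow> \<tau> (opoly_gen x) = \<sigma> x"
    using lift_to_lie_omega_algebra by metis
  show "\<exists>!\<tau>. \<tau> \<in> extensional Lie \<and>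
      lie_omega_hom \<Omega> ar opoly_scale Lie opoly_commutator opoly_op scale' A br' opr' \<tau> \<and>
      (\<forall>x\<in>X. \<tau> (opoly_gen x) = \<sigma> x)"
  proof (rule ex1I[of _ \<tau>])
    fix \<tau>' assume \<tau>': "\<tau>' \<in> extensional Lie \<and>
      lie_omega_hom \<Omega> ar opoly_scale Lie opoly_commutator opoly_op scale' A br' opr' \<tau>' \<and>
      (\<forall>x\<in>X. \<tau>' (opoly_gen x) = \<sigma> x)"
    have "\<tau>' f = \<tau> f" if "f \<in> Lie" for f
      by (rule hom_from_Lie_unique[OF _ \<tau>(2) _ that]) (use \<tau>(3) \<tau>' in auto)
    then show "\<tau>' = \<tau>" using \<tau>(1) \<tau>' by (intro extensionalityI[of _ Lie]) auto
  qed (use \<tau> in auto)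
qed

end

theorem theorem2p8:
  fixes X :: "'x::wellorder set" and \<Omega> :: "'o::wellorder set" and ar :: "'o \<Rightarrow> nat"
  assumes "\<And>\<omega>. \<omega> \<in> \<Omega> \<Longrightarrow> ar \<omega> \<ge> 1"
  shows "free_lie_omega_algebra TYPE('a::ab_group_add) \<Omega> ar X
           opoly_scale (Lie_op X \<Omega> ar :: ('x, 'o, 'k::field) opoly set)
           opoly_commutator opoly_op opoly_gen \<and>
         inj_on (nword_value :: ('x, 'o) nprime nword \<Rightarrow> ('x, 'o, 'k) opoly) (NLSW_op X \<Omega> ar) \<and>
         \<not> module.dependent opoly_scale
             (nword_value ` NLSW_op X \<Omega> ar :: ('x, 'o, 'k) opoly set) \<and>
         module.span opoly_scale (nword_value ` NLSW_op X \<Omega> ar) =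
           (Lie_op X \<Omega> ar :: ('x, 'o, 'k) opoly set)"
proof -
  interpret free_lie_omega X \<Omega> ar "TYPE('k)" by unfold_locales (rule assms)
  have word_values: "(nword_value ` NLSW_op X \<Omega> ar :: ('x, 'o, 'k) opoly set) = word_val ` ALSW_op X \<Omega> ar"
    by (simp add: NLSW_op_def image_image word_val_eq_nword_value)
  have "inj_on (nword_value :: _ \<Rightarrow> ('x, 'o, 'k) opoly) (NLSW_op X \<Omega> ar)"
    unfolding NLSW_op_def
    by (rule inj_on_imageI) (use word_val_basis(1) in \<open>simp add: comp_def word_val_eq_nword_value[abs_def]\<close>)
  then show ?thesis
    unfolding word_values using Lie_free word_val_basis(2) Lie_eq_span by blast
qed

end
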